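(* Let $d$ be an odd positive integer, $n$ a non-negative integer, and $\rho$ a density matrix over $\mathcal{H} = (\mathbb{C}^d)^{\otimes n}$. If $(S,q_\rho,\alpha)$ is a deterministic non-contextual hidden variable model for $\rho$, then the triple $(S,q_\rho,\lambda)$, where for each $\nu\in S$ the map $\lambda_\nu : V\to U_d$ is defined by $\lambda_\nu(\mathbf{u}) = \omega^{\alpha_\nu(\mathbf{u})}$ with $\alpha_\nu(\mathbf{u}) := \alpha_\nu(\{T_{\mathbf{u}}\})\in\mathbb{Z}_d$, is a set of NC value assignments for $\rho$.
   Context: $\mathbb{Z}_d$ is the ring of integers modulo $d$ ($2$ is invertible), $\omega = e^{2i\pi/d}$, $U_d = \{\omega^s \mid s \in \mathbb{Z}_d\}$. Let $(|a\rangle)_{a\in\mathbb{Z}_d}$ be an orthonormal basis of $\mathbb{C}^d$. For $\mathbf{a},\mathbf{b}\in\mathbb{Z}_d^n$, $(\mathbf{a}|\mathbf{b}) = \sum_{i=1}^n a_i b_i$. Vectors of $V = \mathbb{Z}_d^n \times \mathbb{Z}_d^n$ are written $\mathbf{u} = (\mathbf{u_Z},\mathbf{u_X})$, and $[\mathbf{u},\mathbf{v}] = (\mathbf{u_Z}|\mathbf{v_X}) - (\mathbf{u_X}|\mathbf{v_Z}) \in \mathbb{Z}_d$. Pauli matrices: $X|a\rangle = |a+1\rangle$, $Z|a\rangle = \omega^a|a\rangle$; $Z^{\mathbf{a}} = Z^{a_1}\otimes\cdots\otimes Z^{a_n}$, $X^{\mathbf{a}} = X^{a_1}\otimes\cdots\otimes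 X^{a_n}$. Heisenberg-Weyl operators: $T_{\mathbf{u}} = \omega^{-(\mathbf{u_Z}|\mathbf{u_X})/2} Z^{\mathbf{u_Z}}X^{\mathbf{u_X}}$, $\mathbf{u}\in V$ (division by $2$ in $\mathbb{Z}_d$). $T_{\mathbf{u}}$ and $T_{\mathbf{v}}$ commute if and only if $[\mathbf{u},\mathbf{v}]=0$. Set of NC (non-contextual) value assignments for $\rho$: a triple $(S,q_\rho,\lambda)$ where $S$ is a finite set, $q_\rho$ is a probability distribution over $S$, and $\lambda$ is a collection of maps $\lambda_\nu : V\to U_d$, $\nu\in S$, such that (1) for all $\nu\in S$, $\mathbf{u},\mathbf{v}\in V$, $[\mathbf{u},\mathbf{v}]=0$ implies $\lambda_\nu(\mathbf{u}+\mathbf{v}) = \lambda_\nu(\mathbf{u})\lambda_\nu(\mathbf{v})$; (2) for all $\mathbf{u}\in V$, $\operatorname{Tr}(T_{\mathbf{u}}\rho) = \sum_{\nu\in S}\lambda_\nu(\mathbf{u})\,q_\rho(\nu)$. Contexts: a context is an ordered tuple $C = \{T_{\mathbf{a_1}},\dots,T_{\mathbf{a_m}}\}$ of pairwise commuting Heisenberg-Weyl operators; $|C| = m$ and $\mathcal{C}$ is the set of all contexts. For $\mathbf{s}\in\mathbb{Z}_d^m$, $\Pi_C^{\mathbf{s}}$ (also written $\Pi_{\mathbf{a}}^{\mathbf{s}}$) is the projector onto the common eigenspace of $T_{\mathbf{a_1}},\dots,T_{\mathbf{a_m}}$ with respective eigenvalues $\omega^{s_1},\dots,\omega^{s_m}$.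 Hidden variable model (HVM) for $\rho$: a triple $(S,q_\rho,p)$ where $S$ is a set, $q_\rho$ is a probability distribution over $S$, and $p = (p_C)_{C\in\mathcal{C}}$ is a family of conditional probability distributions $p_C(\mathbf{s}|\nu)$ over the outcomes $\mathbf{s}\in\mathbb{Z}_d^{|C|}$, for $C \in \mathcal{C}$ and $\nu\in S$, such that $\operatorname{Tr}(\Pi_C^{\mathbf{s}}\rho) = \sum_{\nu\in S}p_C(\mathbf{s}|\nu)\,q_\rho(\nu)$ for all $C\in\mathcal{C}$ and $\mathbf{s}\in\mathbb{Z}_d^{|C|}$. It is deterministic if for every $\nu\in S$ there is a map $\alpha_\nu$ with $\alpha_\nu(C)\in\mathbb{Z}_d^{|C|}$ for each $C\in\mathcal{C}$ and $p_C(\mathbf{s}|\nu) = \delta_{\alpha_\nu(C),\mathbf{s}}$ for all $C$ and $\mathbf{s}$; such a model is then denoted $(S,q_\rho,\alpha)$. Implementations: a measurement is a family of stabilizer projectors $(\Pi^{\mathbf{s}})_{\mathbf{s}\in O}$ summing to the identity, indexed by the elements of a finite set $O$ (the term "stabilizer projectors" is used without a separate definition; the examples given of such measurements include the families $(\Pi_C^{\mathbf{s}})_{\mathbf{s}}$ and the pair $\{\Pi_{\mathbf{u}}^0,\, I-\Pi_{\mathbf{u}}^0\}$, where $\Pi_{\mathbf{u}}^0$ is the projector onto the eigenspace of $T_{\mathbf{u}}$ with eigenvalue $1$). An implementation of it is a pair $(C,\sigma_C)$ with $C = \{T_{\mathbf{a_1}},\dots,T_{\mathbf{a_m}}\}\in\mathcal{C}$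 and $\sigma_C:\mathbb{Z}_d^m\to O$ a surjective map such that $\Pi^{\mathbf{s}} = \sum_{\mathbf{t}\in\mathbb{Z}_d^m,\ \sigma_C(\mathbf{t})=\mathbf{s}}\Pi_{\mathbf{a}}^{\mathbf{t}}$ for all $\mathbf{s}\in O$. Write $p_C(\sigma_C^{-1}(\mathbf{s})|\nu) = \sum_{\mathbf{t}:\,\sigma_C(\mathbf{t})=\mathbf{s}}p_C(\mathbf{t}|\nu)$. An HVM is non-contextual if for every implementation $(C,\sigma_C)$ of a measurement $(\Pi^{\mathbf{s}})_{\mathbf{s}\in O}$ and every $\nu\in S$, the conditional probability $p_C(\sigma_C^{-1}(\mathbf{s})|\nu)$ depends only on the projector $\Pi^{\mathbf{s}}$ and not on the implementation $(C,\sigma_C)$.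
   Formalization: A hidden variable model may have an infinite set S, while NC value assignments require S finite; so the full conclusion is stated for finite S, and for infinite S all conditions except finiteness of S are proved. *)

theory Defs
  imports
    "HOL-Analysis.Infinite_Sum"
    "HOL-Number_Theory.Modular_Inverse"
    "Jordan_Normal_Form.Schur_Decomposition"
begin

section \<open>Arithmetic over the integers modulo d\<close>

text \<open>Elements of the ring of integers modulo d are represented by their residues in
  \<open>{0..<d}\<close>, and tuples of them by lists.\<close>

definition Zmod :: "nat \<Rightarrow> int set" where
  "Zmod d = {0..<int d}"

definition Zvec :: "nat \<Rightarrow> nat \<Rightarrow> int list set" where
  "Zvec d m = {a. length a = m \<and> set a \<subseteq> Zmod d}"

definition omega :: "nat \<Rightarrow> complex" where
  "omega d = exp (2 * \<i> * of_real pi / of_nat d)"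

definition roots_U :: "nat \<Rightarrow> complex set" where
  "roots_U d = {omega d powi s | s. s \<in> Zmod d}"

definition dot :: "nat \<Rightarrow> int list \<Rightarrow> int list \<Rightarrow> int" where
  "dot d a b = (\<Sum>(x, y) \<leftarrow> zip a b. x * y) mod int d"

text \<open>Phase space vectors are pairs \<open>(u\<^sub>Z, u\<^sub>X)\<close>.\<close>

type_synonym phase_vec = "int list \<times> int list"

definition phase_space :: "nat \<Rightarrow> nat \<Rightarrow> phase_vec set" where
  "phase_space d n = Zvec d n \<times> Zvec d n"

definition Zvec_add :: "nat \<Rightarrow> int list \<Rightarrow> int list \<Rightarrow> int list" where
  "Zvec_add d a b = map2 (\<lambda>x y. (x + y) mod int d) a b"

definition phase_add :: "nat \<Rightarrow> phase_vec \<Rightarrow> phase_vec \<Rightarrow> phase_vec" where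
  "phase_add d u v = (Zvec_add d (fst u) (fst v), Zvec_add d (snd u) (snd v))"

definition symp :: "nat \<Rightarrow> phase_vec \<Rightarrow> phase_vec \<Rightarrow> int" where
  "symp d u v = (dot d (fst u) (snd v) - dot d (snd u) (fst v)) mod int d"


section \<open>Matrices\<close>

definition mat_trace :: "complex mat \<Rightarrow> complex" where
  "mat_trace A = (\<Sum>i<dim_row A. A $$ (i, i))"

definition mat_sum :: "nat \<Rightarrow> ('a \<Rightarrow> complex mat) \<Rightarrow> 'a set \<Rightarrow> complex mat" where
  "mat_sum N f A = mat N N (\<lambda>ij. \<Sum>t\<in>A. f t $$ ij)"

text \<open>Kronecker product; the basis vector \<open>|a\<rangle> \<otimes> |b\<rangle>\<close> has index \<open>a * m + b\<close>, where \<open>m\<close> is the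
  dimension of the second factor.\<close>

definition kron :: "complex mat \<Rightarrow> complex mat \<Rightarrow> complex mat" where
  "kron A B = mat (dim_row A * dim_row B) (dim_col A * dim_col B)
     (\<lambda>(i, j). A $$ (i div dim_row B, j div dim_col B) * B $$ (i mod dim_row B, j mod dim_col B))"

definition kron_list :: "complex mat list \<Rightarrow> complex mat" where
  "kron_list As = foldr kron As (1\<^sub>m 1)"

definition density_matrix :: "nat \<Rightarrow> complex mat \<Rightarrow> bool" where
  "density_matrix N \<rho> \<longleftrightarrow> \<rho> \<in> carrier_mat N N \<and> mat_adjoint \<rho> = \<rho> \<and>
     (\<forall>v \<in> carrier_vec N. 0 \<le> (\<rho> *\<^sub>v v) \<bullet>c v) \<and> mat_trace \<rho> = 1"

definition orthogonal_projector_onto :: "nat \<Rightarrow> complex vec set \<Rightarrow> complex mat \<Rightarrow> bool" where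
  "orthogonal_projector_onto N W P \<longleftrightarrow> P \<in> carrier_mat N N \<and> P * P = P \<and> mat_adjoint P = P \<and>
     (\<lambda>v. P *\<^sub>v v) ` carrier_vec N = W"


section \<open>Heisenberg-Weyl operators and contexts\<close>

definition pauli_X :: "nat \<Rightarrow> complex mat" where
  "pauli_X d = mat d d (\<lambda>(i, j). if i = (j + 1) mod d then 1 else 0)"

definition pauli_Z :: "nat \<Rightarrow> complex mat" where
  "pauli_Z d = mat d d (\<lambda>(i, j). if i = j then omega d ^ i else 0)"

definition pauli_X_vec :: "nat \<Rightarrow> int list \<Rightarrow> complex mat" where
  "pauli_X_vec d a = kron_list (map (\<lambda>x. pauli_X d ^\<^sub>m nat x) a)"

definition pauli_Z_vec :: "nat \<Rightarrow> int list \<Rightarrow> complex mat" where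
  "pauli_Z_vec d a = kron_list (map (\<lambda>x. pauli_Z d ^\<^sub>m nat x) a)"

definition weyl :: "nat \<Rightarrow> phase_vec \<Rightarrow> complex mat" where
  "weyl d u = omega d powi (- (modular_inverse (int d) 2 * dot d (fst u) (snd u)))
     \<cdot>\<^sub>m (pauli_Z_vec d (fst u) * pauli_X_vec d (snd u))"

definition contexts :: "nat \<Rightarrow> nat \<Rightarrow> complex mat list set" where
  "contexts d n = {C. set C \<subseteq> weyl d ` phase_space d n \<and> (\<forall>A \<in> set C. \<forall>B \<in> set C. A * B = B * A)}"

definition common_eigenspace :: "nat \<Rightarrow> nat \<Rightarrow> complex mat list \<Rightarrow> int list \<Rightarrow> complex vec set" where
  "common_eigenspace d n C s =
     {v \<in> carrier_vec (d ^ n). \<forall>i < length C. C ! i *\<^sub>v v = omega d powi (s ! i) \<cdot>\<^sub>v v}"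

definition eigenprojector :: "nat \<Rightarrow> nat \<Rightarrow> complex mat list \<Rightarrow> int list \<Rightarrow> complex mat" where
  "eigenprojector d n C s = (THE P. orthogonal_projector_onto (d ^ n) (common_eigenspace d n C s) P)"


section \<open>Value assignments\<close>

definition prob_dist_on :: "'h set \<Rightarrow> ('h \<Rightarrow> real) \<Rightarrow> bool" where
  "prob_dist_on S q \<longleftrightarrow> (\<forall>\<nu>\<in>S. 0 \<le> q \<nu>) \<and> (q has_sum 1) S"

text \<open>The conditions on value assignments make sense for an arbitrary set \<open>S\<close>. For finite \<open>S\<close>,
  \<open>has_sum\<close> is the finite sum.\<close>

definition value_assignments ::
  "nat \<Rightarrow> nat \<Rightarrow> complex mat \<Rightarrow> 'h set \<Rightarrow> ('h \<Rightarrow> real) \<Rightarrow> ('h \<Rightarrow> phase_vec \<Rightarrow> complex) \<Rightarrow> bool" where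
  "value_assignments d n \<rho> S q l \<longleftrightarrow>
     prob_dist_on S q \<and>
     (\<forall>\<nu>\<in>S. \<forall>u\<in>phase_space d n. l \<nu> u \<in> roots_U d) \<and>
     (\<forall>\<nu>\<in>S. \<forall>u\<in>phase_space d n. \<forall>v\<in>phase_space d n.
        symp d u v = 0 \<longrightarrow> l \<nu> (phase_add d u v) = l \<nu> u * l \<nu> v) \<and>
     (\<forall>u\<in>phase_space d n.
        ((\<lambda>\<nu>. l \<nu> u * of_real (q \<nu>)) has_sum mat_trace (weyl d u * \<rho>)) S)"

definition nc_value_assignments ::
  "nat \<Rightarrow> nat \<Rightarrow> complex mat \<Rightarrow> 'h set \<Rightarrow> ('h \<Rightarrow> real) \<Rightarrow> ('h \<Rightarrow> phase_vec \<Rightarrow> complex) \<Rightarrow> bool" where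
  "nc_value_assignments d n \<rho> S q l \<longleftrightarrow> finite S \<and> value_assignments d n \<rho> S q l"


section \<open>Hidden variable models\<close>

text \<open>\<open>p C s \<nu>\<close> is the probability of the outcome \<open>s\<close> of \<open>C\<close> conditioned on \<open>\<nu>\<close>.\<close>

type_synonym 'h response = "complex mat list \<Rightarrow> int list \<Rightarrow> 'h \<Rightarrow> real"

definition hidden_variable_model ::
  "nat \<Rightarrow> nat \<Rightarrow> complex mat \<Rightarrow> 'h set \<Rightarrow> ('h \<Rightarrow> real) \<Rightarrow> 'h response \<Rightarrow> bool" where
  "hidden_variable_model d n \<rho> S q p \<longleftrightarrow>
     prob_dist_on S q \<and>
     (\<forall>C\<in>contexts d n. \<forall>\<nu>\<in>S.
        (\<forall>s\<in>Zvec d (length C). 0 \<le> p C s \<nu>) \<and> (\<Sum>s\<in>Zvec d (length C). p C s \<nu>) = 1) \<and>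
     (\<forall>C\<in>contexts d n. \<forall>s\<in>Zvec d (length C).
        ((\<lambda>\<nu>. of_real (p C s \<nu> * q \<nu>)) has_sum mat_trace (eigenprojector d n C s * \<rho>)) S)"

definition deterministic_with ::
  "nat \<Rightarrow> nat \<Rightarrow> 'h set \<Rightarrow> 'h response \<Rightarrow> ('h \<Rightarrow> complex mat list \<Rightarrow> int list) \<Rightarrow> bool" where
  "deterministic_with d n S p \<alpha> \<longleftrightarrow>
     (\<forall>\<nu>\<in>S. \<forall>C\<in>contexts d n. \<alpha> \<nu> C \<in> Zvec d (length C) \<and>
        (\<forall>s\<in>Zvec d (length C). p C s \<nu> = (if \<alpha> \<nu> C = s then 1 else 0)))"

text \<open>A stabilizer projector is a sum of joint eigenprojectors of a context. Sums over arbitrary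
  sets of outcomes are needed in order to include complements of eigenprojectors.\<close>

definition stabilizer_projector :: "nat \<Rightarrow> nat \<Rightarrow> complex mat \<Rightarrow> bool" where
  "stabilizer_projector d n P \<longleftrightarrow>
     (\<exists>C\<in>contexts d n. \<exists>A\<subseteq>Zvec d (length C). P = mat_sum (d ^ n) (eigenprojector d n C) A)"

text \<open>Labels of measurement outcomes are taken to be integer lists: this contains the index sets
  \<open>Zvec d m\<close>, and every finite index set is in bijection with a finite set of integer lists.\<close>

definition measurement :: "nat \<Rightarrow> nat \<Rightarrow> int list set \<Rightarrow> (int list \<Rightarrow> complex mat) \<Rightarrow> bool" where
  "measurement d n O_set P \<longleftrightarrow> finite O_set \<and> (\<forall>s\<in>O_set. stabilizer_projector d n (P s)) \<and>
     mat_sum (d ^ n) P O_set = 1\<^sub>m (d ^ n)"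

definition implementation ::
  "nat \<Rightarrow> nat \<Rightarrow> int list set \<Rightarrow> (int list \<Rightarrow> complex mat) \<Rightarrow>
     complex mat list \<Rightarrow> (int list \<Rightarrow> int list) \<Rightarrow> bool" where
  "implementation d n O_set P C \<sigma> \<longleftrightarrow> C \<in> contexts d n \<and> \<sigma> ` Zvec d (length C) = O_set \<and>
     (\<forall>s\<in>O_set. P s = mat_sum (d ^ n) (eigenprojector d n C) {t \<in> Zvec d (length C). \<sigma> t = s})"

definition coarse_prob ::
  "nat \<Rightarrow> 'h response \<Rightarrow> complex mat list \<Rightarrow> (int list \<Rightarrow> int list) \<Rightarrow> int list \<Rightarrow> 'h \<Rightarrow> real" where
  "coarse_prob d p C \<sigma> s \<nu> = (\<Sum>t \<in> {t \<in> Zvec d (length C). \<sigma> t = s}. p C t \<nu>)"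

definition noncontextual :: "nat \<Rightarrow> nat \<Rightarrow> 'h set \<Rightarrow> 'h response \<Rightarrow> bool" where
  "noncontextual d n S p \<longleftrightarrow>
     (\<forall>O_set P C \<sigma> O_set' P' C' \<sigma>'.
        measurement d n O_set P \<and> implementation d n O_set P C \<sigma> \<and>
        measurement d n O_set' P' \<and> implementation d n O_set' P' C' \<sigma>' \<longrightarrow>
        (\<forall>s\<in>O_set. \<forall>s'\<in>O_set'. \<forall>\<nu>\<in>S. P s = P' s' \<longrightarrow>
           coarse_prob d p C \<sigma> s \<nu> = coarse_prob d p C' \<sigma>' s' \<nu>))"

end

theory Submission
  imports Defs
begin

text \<open>Let \<open>[u, v] = 0\<close>, so that \<open>T\<^sub>u\<close> and \<open>T\<^sub>v\<close> commute and \<open>T\<^sub>u T\<^sub>v\<close> is the operator of \<open>u + v\<close>. The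
  spectral projectors of each of these three operators are coarse-grainings of the joint spectral
  projectors of the context \<open>C = {T\<^sub>u, T\<^sub>v}\<close>, along \<open>t \<mapsto> t\<^sub>1\<close>, \<open>t \<mapsto> t\<^sub>2\<close> and \<open>t \<mapsto> t\<^sub>1 + t\<^sub>2\<close>. By
  non-contextuality the three values are the images of the single outcome assigned to \<open>C\<close>, hence
  additive. The trace condition is the spectral decomposition of \<open>T\<^sub>u\<close>. All projectors are explicit:
  \<open>T\<^sub>u\<close> has order dividing \<open>d\<close>, so its \<open>\<omega>\<^sup>k\<close>-eigenprojector is the average of \<open>\<omega>\<^sup>-\<^sup>k\<^sup>j T\<^sub>u\<^sup>j\<close>
  over \<open>j < d\<close>.\<close>

section \<open>Roots of unity\<close>

text \<open>\<open>eigenprojector\<close> is a definite description, so the projectors that the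
  model refers to must first be exhibited. The averages are multiplied over a context, and the
  product is recognised because an orthogonal projector is determined by its range. Oddness of d
  enters through the half in the phase of T_u: with 2 invertible, the phases of commuting operators
  combine to that of the sum, hence T_u^j = T_{ju} and T_u^d = 1. Joint eigenspaces may be zero, for
  instance for unequal outcomes when u = v. Labels of such outcomes still count: a deterministic
  model could a priori assign one, and a coarse-graining must reach every residue. Implementations
  are compared only through equality of projectors, so zero projectors are treated like all
  others.\<close>

lemma omega_nonzero [simp]: "omega d \<noteq> 0"
  by (simp add: omega_def)

lemma omega_powi_cis: "omega d powi k = cis (2 * pi * of_int k / of_nat d)"
proof -
  have "omega d = cis (2 * pi / of_nat d)"
    by (simp add: omega_def cis_conv_exp mult_ac)
  then show ?thesis
    by (simp add: cis_power_int mult_ac)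
qed

lemma cnj_omega_powi: "cnj (omega d powi k) = omega d powi (- k)"
  by (simp add: omega_powi_cis cis_cnj)

lemma omega_powi_multiple:
  assumes "d > 0"
  shows "omega d powi (int d * k) = 1"
proof -
  have "omega d powi int d = 1"
    using assms by (simp only: omega_powi_cis) simp
  then show ?thesis by (simp add: power_int_mult)
qed

lemma omega_powi_mod [simp]:
  assumes "d > 0"
  shows "omega d powi (k mod int d) = omega d powi k"
proof -
  have "omega d powi k = omega d powi (int d * (k div int d) + k mod int d)" by simp
  also have "\<dots> = omega d powi (k mod int d)"
    by (subst power_int_add) (simp_all only: omega_powi_multiple[OF assms], simp_all)
  finally show ?thesis by simp
qed

lemma omega_powi_cong:
  assumes "d > 0" "k mod int d = j mod int d"
  shows "omega d powi k = omega d powi j"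
  using omega_powi_mod[OF assms(1), of k] omega_powi_mod[OF assms(1), of j] assms(2) by simp

text \<open>Primitivity of the root: distinct residues below d give distinct points of the unit
  circle, so residue 0 alone gives 1.\<close>

lemma omega_powi_eq_1_iff:
  assumes "d > 0"
  shows "omega d powi k = 1 \<longleftrightarrow> int d dvd k"
proof
  assume "int d dvd k"
  then show "omega d powi k = 1" using omega_powi_multiple[OF assms] by (auto elim: dvdE)
next
  assume *: "omega d powi k = 1"
  define j where "j = nat (k mod int d)"
  have j: "j < d" "int j = k mod int d"
    using assms by (auto simp: j_def nat_less_iff)
  have "cis (2 * pi * real j / real d) = 1"
    using * omega_powi_mod[OF assms, of k] unfolding j(2)[symmetric] omega_powi_cis by simp
  also have "\<dots> = cis (2 * pi * real 0 / real d)" by simp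
  finally have "j = 0"
    using bij_betw_imp_inj_on[OF bij_betw_roots_unity[OF assms]] j(1) assms
    by (auto simp: inj_on_def)
  then show "int d dvd k" using j(2) by (simp add: mod_eq_0_iff_dvd)
qed

text \<open>Orthogonality of the characters of Z_d. If z = omega^r differs from 1, the geometric sum
  is (z^d - 1) / (z - 1), and z^d = 1.\<close>

lemma sum_omega_powi:
  assumes "d > 0"
  shows "(\<Sum>j<d. omega d powi (r * int j)) = (if int d dvd r then of_nat d else 0)"
proof -
  define z where "z = omega d powi r"
  have z: "omega d powi (r * int j) = z ^ j" for j
    by (simp add: z_def power_int_mult)
  have "z ^ d = 1"
    unfolding z[symmetric] using omega_powi_multiple[OF assms, of r] by (simp add: mult.commute)
  show ?thesis
  proof (cases "int d dvd r")
    case True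
    then have "z = 1" using omega_powi_eq_1_iff[OF assms] by (simp add: z_def)
    then show ?thesis using True by (simp add: z)
  next
    case False
    then have "z \<noteq> 1" using omega_powi_eq_1_iff[OF assms] by (simp add: z_def)
    then have "(\<Sum>j<d. z ^ j) = 0" by (simp add: geometric_sum \<open>z ^ d = 1\<close>)
    then show ?thesis using False by (simp only: z if_False)
  qed
qed

section \<open>Matrix sums and adjoints\<close>

lemma smult_smult_mat: "a \<cdot>\<^sub>m (b \<cdot>\<^sub>m A) = (a * b :: 'a :: semigroup_mult) \<cdot>\<^sub>m A"
  by (rule eq_matI) (auto simp: mult.assoc)

lemma smult_one_mat [simp]: "1 \<cdot>\<^sub>m A = (A :: 'a :: monoid_mult mat)"
  by (rule eq_matI) auto

lemma mat_sum_carrier [simp]: "mat_sum N f S \<in> carrier_mat N N"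
  by (simp add: mat_sum_def)

lemma mat_sum_dim [simp]: "dim_row (mat_sum N f S) = N" "dim_col (mat_sum N f S) = N"
  by (simp_all add: mat_sum_def)

lemma mat_sum_index [simp]:
  "i < N \<Longrightarrow> j < N \<Longrightarrow> mat_sum N f S $$ (i, j) = (\<Sum>t\<in>S. f t $$ (i, j))"
  by (simp add: mat_sum_def)

lemma mat_sum_cong: "(\<And>t. t \<in> S \<Longrightarrow> f t = g t) \<Longrightarrow> mat_sum N f S = mat_sum N g S"
  by (simp add: mat_sum_def)

lemma mat_mult_index:
  assumes "A \<in> carrier_mat a b" "B \<in> carrier_mat b c" "i < a" "j < c"
  shows "(A * B) $$ (i, j) = (\<Sum>k<b. A $$ (i, k) * B $$ (k, j))"
  using assms by (auto simp: scalar_prod_def lessThan_atLeast0 intro!: sum.cong)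

text \<open>The right factor may be rectangular because eigenvectors enter later as matrices with a
  single column.\<close>

lemma mat_sum_mult_index:
  assumes "\<And>t. t \<in> S \<Longrightarrow> f t \<in> carrier_mat N N" "Y \<in> carrier_mat N m" "i < N" "j < m"
  shows "(mat_sum N f S * Y) $$ (i, j) = (\<Sum>t\<in>S. (f t * Y) $$ (i, j))"
proof -
  have "(mat_sum N f S * Y) $$ (i, j) = (\<Sum>k<N. (\<Sum>t\<in>S. f t $$ (i, k)) * Y $$ (k, j))"
    using assms by (subst mat_mult_index[of _ N N _ m]) simp_all
  also have "\<dots> = (\<Sum>t\<in>S. \<Sum>k<N. f t $$ (i, k) * Y $$ (k, j))"
    by (simp add: sum_distrib_right sum.swap[of _ S])
  also have "\<dots> = (\<Sum>t\<in>S. (f t * Y) $$ (i, j))"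
    using assms by (intro sum.cong refl mat_mult_index[symmetric]) auto
  finally show ?thesis .
qed

lemma mult_mat_sum_index:
  assumes "\<And>t. t \<in> S \<Longrightarrow> f t \<in> carrier_mat N N" "X \<in> carrier_mat m N" "i < m" "j < N"
  shows "(X * mat_sum N f S) $$ (i, j) = (\<Sum>t\<in>S. (X * f t) $$ (i, j))"
proof -
  have "(X * mat_sum N f S) $$ (i, j) = (\<Sum>k<N. X $$ (i, k) * (\<Sum>t\<in>S. f t $$ (k, j)))"
    using assms by (subst mat_mult_index[of _ m N _ N]) simp_all
  also have "\<dots> = (\<Sum>t\<in>S. \<Sum>k<N. X $$ (i, k) * f t $$ (k, j))"
    by (simp add: sum_distrib_left sum.swap[of _ S])
  also have "\<dots> = (\<Sum>t\<in>S. (X * f t) $$ (i, j))"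
    using assms by (intro sum.cong refl mat_mult_index[symmetric]) auto
  finally show ?thesis .
qed

lemma mat_sum_mult:
  assumes "\<And>t. t \<in> S \<Longrightarrow> f t \<in> carrier_mat N N" "Y \<in> carrier_mat N N"
  shows "mat_sum N f S * Y = mat_sum N (\<lambda>t. f t * Y) S"
  using assms by (intro eq_matI) (auto simp: mat_sum_mult_index[of S f N Y N] simp del: index_mult_mat(1))

lemma mult_mat_sum:
  assumes "\<And>t. t \<in> S \<Longrightarrow> f t \<in> carrier_mat N N" "X \<in> carrier_mat N N"
  shows "X * mat_sum N f S = mat_sum N (\<lambda>t. X * f t) S"
  using assms by (intro eq_matI) (auto simp: mult_mat_sum_index[of S f N X N] simp del: index_mult_mat(1))

lemma mat_adjoint_dim [simp]:
  "dim_row (mat_adjoint A) = dim_col A" "dim_col (mat_adjoint A) = dim_row A"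
  by (simp_all add: mat_adjoint_def)

lemma mat_adjoint_carrier [simp]:
  "A \<in> carrier_mat n m \<Longrightarrow> mat_adjoint A \<in> carrier_mat m n"
  by (auto intro!: carrier_matI)

lemma mat_adjoint_index [simp]:
  fixes A :: "complex mat"
  shows "i < dim_col A \<Longrightarrow> j < dim_row A \<Longrightarrow> mat_adjoint A $$ (i, j) = cnj (A $$ (j, i))"
  by (simp add: mat_adjoint_def mat_of_rows_def)

lemma mat_adjoint_adjoint [simp]:
  fixes A :: "complex mat"
  shows "mat_adjoint (mat_adjoint A) = A"
  by (rule eq_matI) auto

lemma mat_adjoint_smult:
  fixes A :: "complex mat"
  shows "mat_adjoint (c \<cdot>\<^sub>m A) = cnj c \<cdot>\<^sub>m mat_adjoint A"
  by (rule eq_matI) auto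

lemma mat_adjoint_one [simp]: "mat_adjoint (1\<^sub>m n :: complex mat) = 1\<^sub>m n"
  by (rule eq_matI) auto

lemma mat_adjoint_mult:
  fixes A :: "complex mat"
  assumes "A \<in> carrier_mat a b" "B \<in> carrier_mat b c"
  shows "mat_adjoint (A * B) = mat_adjoint B * mat_adjoint A"
proof (rule eq_matI)
  fix i j assume "i < dim_row (mat_adjoint B * mat_adjoint A)"
    "j < dim_col (mat_adjoint B * mat_adjoint A)"
  then have ij: "i < c" "j < a" using assms by auto
  have "mat_adjoint (A * B) $$ (i, j) = cnj ((A * B) $$ (j, i))"
    using ij assms by (intro mat_adjoint_index) auto
  also have "\<dots> = (\<Sum>k<b. cnj (B $$ (k, i)) * cnj (A $$ (j, k)))"
    using ij assms by (subst mat_mult_index[of A a b B c]) (simp_all add: mult.commute)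
  also have "\<dots> = (mat_adjoint B * mat_adjoint A) $$ (i, j)"
    using ij assms by (subst mat_mult_index[of _ c b _ a]) auto
  finally show "mat_adjoint (A * B) $$ (i, j) = (mat_adjoint B * mat_adjoint A) $$ (i, j)" .
qed (use assms in auto)

lemma mat_adjoint_mult_one_mult:
  fixes A :: "complex mat"
  assumes "A \<in> carrier_mat n n" "B \<in> carrier_mat n n"
    and "mat_adjoint A * A = 1\<^sub>m n" "mat_adjoint B * B = 1\<^sub>m n"
  shows "mat_adjoint (A * B) * (A * B) = 1\<^sub>m n"
proof -
  have "mat_adjoint A * (A * B) = mat_adjoint A * A * B"
    using assms by (intro assoc_mult_mat[of _ n n _ n _ n, symmetric]) auto
  also have "\<dots> = B" using assms by simp
  finally have "mat_adjoint A * (A * B) = B" .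
  moreover have "mat_adjoint B * mat_adjoint A * (A * B) = mat_adjoint B * (mat_adjoint A * (A * B))"
    using assms by (intro assoc_mult_mat[of _ n n _ n _ n]) auto
  ultimately show ?thesis
    using assms by (simp add: mat_adjoint_mult[OF assms(1,2)])
qed

lemma mat_adjoint_pow_mult_pow:
  fixes A :: "complex mat"
  assumes "A \<in> carrier_mat n n" "mat_adjoint A * A = 1\<^sub>m n"
  shows "mat_adjoint (A ^\<^sub>m k) * A ^\<^sub>m k = 1\<^sub>m n"
proof (induction k)
  case 0
  then show ?case using assms by simp
next
  case (Suc k)
  have "mat_adjoint (A ^\<^sub>m k * A) * (A ^\<^sub>m k * A) = 1\<^sub>m n"
    by (rule mat_adjoint_mult_one_mult) (use assms Suc in simp_all)
  then show ?case by simp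
qed

lemma pow_mat_commute:
  fixes A :: "'a :: semiring_1 mat"
  assumes "A \<in> carrier_mat n n" "B \<in> carrier_mat n n" "B * A = A * B"
  shows "B * A ^\<^sub>m k = A ^\<^sub>m k * B"
proof (induction k)
  case 0
  then show ?case using assms by simp
next
  case (Suc k)
  have "B * A ^\<^sub>m Suc k = B * A ^\<^sub>m k * A"
    using assms by (simp add: assoc_mult_mat[of _ n n _ n _ n])
  also have "\<dots> = A ^\<^sub>m k * (B * A)"
    unfolding Suc using assms by (simp add: assoc_mult_mat[of _ n n _ n _ n])
  also have "\<dots> = A ^\<^sub>m Suc k * B"
    using assms by (simp add: assoc_mult_mat[of _ n n _ n _ n])
  finally show ?case .
qed

section \<open>Spectral projectors of operators of finite order\<close>

definition spec_proj :: "nat \<Rightarrow> nat \<Rightarrow> complex mat \<Rightarrow> int \<Rightarrow> complex mat" where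
  "spec_proj d N A k =
     mat_sum N (\<lambda>j. (omega d powi (- (k * int j)) / of_nat d) \<cdot>\<^sub>m A ^\<^sub>m j) {..<d}"

lemma spec_proj_carrier [simp]: "spec_proj d N A k \<in> carrier_mat N N"
  by (simp add: spec_proj_def)

lemma spec_proj_dim [simp]:
  "dim_row (spec_proj d N A k) = N" "dim_col (spec_proj d N A k) = N"
  by (simp_all add: spec_proj_def)

text \<open>The scalar by which the average for k acts on an eigenvector with eigenvalue omega^r: a
  Kronecker delta on residues.\<close>

lemma sum_spec_coeff:
  assumes "d > 0"
  shows "(\<Sum>j<d. omega d powi (- (k * int j)) / of_nat d * omega d powi (r * int j))
    = (if int d dvd r - k then 1 else 0)"
proof -
  have "(\<Sum>j<d. omega d powi (- (k * int j)) / of_nat d * omega d powi (r * int j))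
      = (\<Sum>j<d. omega d powi ((r - k) * int j)) / of_nat d"
    unfolding sum_divide_distrib
    by (intro sum.cong) (auto simp: algebra_simps power_int_add[symmetric])
  then show ?thesis using assms by (simp add: sum_omega_powi)
qed

text \<open>On the columns of Y every power of A is a scalar, so the average collapses to a
  character sum.\<close>

lemma spec_proj_mult_eigen:
  assumes "d > 0" "A \<in> carrier_mat N N" "Y \<in> carrier_mat N m"
    and "A * Y = omega d powi r \<cdot>\<^sub>m Y"
  shows "spec_proj d N A k * Y = (if int d dvd r - k then Y else 0\<^sub>m N m)"
proof -
  have pow: "A ^\<^sub>m j * Y = omega d powi (r * int j) \<cdot>\<^sub>m Y" for j
  proof (induction j)
    case (Suc j)
    have "A ^\<^sub>m Suc j * Y = omega d powi r \<cdot>\<^sub>m (A ^\<^sub>m j * Y)"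
      using assms by (simp add: assoc_mult_mat[of _ N N _ N _ m] mult_smult_distrib[of _ N N _ m])
    then show ?case
      by (simp add: Suc smult_smult_mat algebra_simps power_int_add)
  qed (use assms in simp)
  have "(spec_proj d N A k * Y) $$ (i, j) = (if int d dvd r - k then Y $$ (i, j) else 0)"
    if "i < N" "j < m" for i j
  proof -
    have "(spec_proj d N A k * Y) $$ (i, j)
      = (\<Sum>t<d. omega d powi (- (k * int t)) / of_nat d * omega d powi (r * int t)) * Y $$ (i, j)"
      unfolding spec_proj_def sum_distrib_right using assms that
      by (subst mat_sum_mult_index[of _ _ _ _ m])
         (auto intro!: sum.cong simp: mult_smult_assoc_mat[of _ N N _ m] pow simp del: times_divide_eq_left)
    then show ?thesis by (simp only: sum_spec_coeff[OF assms(1)] if_distrib if_distribR) simp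
  qed
  then show ?thesis using assms by (intro eq_matI) auto
qed

text \<open>Counterpart for left factors. It serves self-adjointness, where the adjoint of a
  projector stands on the left.\<close>

lemma mult_spec_proj_eigen:
  assumes "d > 0" "A \<in> carrier_mat N N" "X \<in> carrier_mat N N"
    and "X * A = omega d powi k \<cdot>\<^sub>m X"
  shows "X * spec_proj d N A k = X"
proof -
  have pow: "X * A ^\<^sub>m j = omega d powi (k * int j) \<cdot>\<^sub>m X" for j
  proof (induction j)
    case (Suc j)
    have "X * A ^\<^sub>m Suc j = (X * A ^\<^sub>m j) * A"
      using assms by (simp add: assoc_mult_mat[of _ N N _ N _ N])
    then show ?case using assms
      by (simp add: Suc mult_smult_assoc_mat[of _ N N _ N] smult_smult_mat algebra_simps power_int_add)
  qed (use assms in simp)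
  have "(X * spec_proj d N A k) $$ (i, j) = X $$ (i, j)" if "i < N" "j < N" for i j
  proof -
    have "(X * spec_proj d N A k) $$ (i, j)
      = (\<Sum>t<d. omega d powi (- (k * int t)) / of_nat d * omega d powi (k * int t)) * X $$ (i, j)"
      unfolding spec_proj_def sum_distrib_right using assms that
      by (subst mult_mat_sum_index[of _ _ _ _ N])
         (auto intro!: sum.cong simp: mult_smult_distrib[of _ N N _ N] pow simp del: times_divide_eq_left)
    then show ?thesis by (simp only: sum_spec_coeff[OF assms(1)]) simp
  qed
  then show ?thesis using assms by (intro eq_matI) auto
qed

text \<open>Multiplication by A shifts the summation index by one. Since A^d = 1 and omega^d = 1,
  the summands have period d, and the shift only permutes them cyclically.\<close>

lemma spec_proj_eigen:
  assumes "d > 0" "A \<in> carrier_mat N N" "A ^\<^sub>m d = 1\<^sub>m N"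
  shows "A * spec_proj d N A k = omega d powi k \<cdot>\<^sub>m spec_proj d N A k"
proof (rule eq_matI)
  fix i j assume "i < dim_row (omega d powi k \<cdot>\<^sub>m spec_proj d N A k)"
    "j < dim_col (omega d powi k \<cdot>\<^sub>m spec_proj d N A k)"
  then have ij: "i < N" "j < N" by auto
  define g where "g t = omega d powi (- (k * int t)) / of_nat d * (A ^\<^sub>m t) $$ (i, j)" for t
  \<comment> \<open>\<open>pow_mat\<close> appends its new factor on the right, whereas here it
    arrives from the left.\<close>
  have comm: "A * A ^\<^sub>m t = A ^\<^sub>m Suc t" for t
    using pow_mat_commute[OF assms(2) assms(2)] by simp
  have "(A * spec_proj d N A k) $$ (i, j)
    = (\<Sum>t<d. (A * ((omega d powi (- (k * int t)) / of_nat d) \<cdot>\<^sub>m A ^\<^sub>m t)) $$ (i, j))"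
    unfolding spec_proj_def using assms(2) ij by (intro mult_mat_sum_index[of _ _ _ _ N]) auto
  also have "\<dots> = (\<Sum>t<d. omega d powi k * g (Suc t))"
  proof (rule sum.cong)
    fix t
    have "omega d powi (- (k * int t)) = omega d powi k * omega d powi (- (k * int (Suc t)))"
      by (simp add: algebra_simps flip: power_int_add)
    moreover have "A * ((omega d powi (- (k * int t)) / of_nat d) \<cdot>\<^sub>m A ^\<^sub>m t)
        = (omega d powi (- (k * int t)) / of_nat d) \<cdot>\<^sub>m A ^\<^sub>m Suc t"
      using assms(2) by (subst mult_smult_distrib[of _ N N _ N]) (simp_all only: comm pow_carrier_mat)
    moreover have "dim_row (A ^\<^sub>m Suc t) = N" "dim_col (A ^\<^sub>m Suc t) = N"
      using assms(2) by auto
    ultimately show "(A * ((omega d powi (- (k * int t)) / of_nat d) \<cdot>\<^sub>m A ^\<^sub>m t)) $$ (i, j)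
        = omega d powi k * g (Suc t)"
      using ij by (simp add: g_def del: pow_mat.simps of_nat_Suc)
  qed simp
  also have "\<dots> = omega d powi k * (\<Sum>t<d. g (Suc t))"
    by (simp add: sum_distrib_left)
  also have "(\<Sum>t<d. g (Suc t)) = (\<Sum>t<d. g t)"
  proof -
    have "g d = g 0"
      using assms omega_powi_multiple[OF assms(1), of "-k"]
      by (simp add: g_def mult.commute)
    moreover have "g 0 + (\<Sum>t<d. g (Suc t)) = (\<Sum>t<d. g t) + g d"
      by (metis sum.lessThan_Suc sum.lessThan_Suc_shift)
    ultimately show ?thesis by simp
  qed
  also have "omega d powi k * (\<Sum>t<d. g t) = (omega d powi k \<cdot>\<^sub>m spec_proj d N A k) $$ (i, j)"
    using ij assms(2) by (simp add: spec_proj_def g_def)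
  finally show "(A * spec_proj d N A k) $$ (i, j)
    = (omega d powi k \<cdot>\<^sub>m spec_proj d N A k) $$ (i, j)" .
qed (use assms in auto)

lemma spec_proj_commute:
  assumes "A \<in> carrier_mat N N" "B \<in> carrier_mat N N" "B * A = A * B"
  shows "B * spec_proj d N A k = spec_proj d N A k * B"
proof -
  have "B * (c \<cdot>\<^sub>m A ^\<^sub>m j) = (c \<cdot>\<^sub>m A ^\<^sub>m j) * B" for c j
    using assms by (simp add: mult_smult_distrib[of _ N N _ N] mult_smult_assoc_mat[of _ N N _ N]
        pow_mat_commute[OF assms])
  then show ?thesis
    unfolding spec_proj_def using assms by (simp add: mult_mat_sum mat_sum_mult)
qed

text \<open>Fourier inversion: the coefficient of A^t, summed over all k, is a character sum that
  vanishes for 0 < t < d, leaving A^0.\<close>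

lemma sum_spec_proj:
  assumes "d > 0" "A \<in> carrier_mat N N"
  shows "mat_sum N (spec_proj d N A) (Zmod d) = 1\<^sub>m N"
proof (rule eq_matI)
  fix i j assume "i < dim_row (1\<^sub>m N :: complex mat)" "j < dim_col (1\<^sub>m N :: complex mat)"
  then have ij: "i < N" "j < N" by auto
  \<comment> \<open>Residues are integers, while the character sums run over natural numbers below
    d.\<close>
  have Z: "Zmod d = int ` {..<d}"
    by (simp add: Zmod_def lessThan_atLeast0 image_int_atLeastLessThan)
  have "mat_sum N (spec_proj d N A) (Zmod d) $$ (i, j)
    = (\<Sum>k<d. \<Sum>t<d. omega d powi (- (int k * int t)) / of_nat d * (A ^\<^sub>m t) $$ (i, j))"
    using ij assms(2) by (simp add: Z sum.reindex spec_proj_def)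
  also have "\<dots> = (\<Sum>t<d. (\<Sum>k<d. omega d powi ((- int t) * int k)) / of_nat d * (A ^\<^sub>m t) $$ (i, j))"
    by (subst sum.swap)
       (simp only: sum_distrib_right sum_divide_distrib mult_minus_left mult.commute[of "int _" "int _"])
  also have "\<dots> = (\<Sum>t<d. if t = 0 then (A ^\<^sub>m 0) $$ (i, j) else 0)"
    using assms(1) by (intro sum.cong) (auto simp: sum_omega_powi simp del: mult_minus_left dest: zdvd_imp_le)
  also have "\<dots> = 1\<^sub>m N $$ (i, j)"
    using assms by simp
  finally show "mat_sum N (spec_proj d N A) (Zmod d) $$ (i, j) = 1\<^sub>m N $$ (i, j)" .
qed auto

text \<open>Q fixes the columns of P, which lie in the common range, so Q P = P; likewise P Q = Q.
  Taking adjoints of the first equation gives P = P Q = Q.\<close>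

lemma orthogonal_projector_onto_unique:
  assumes "orthogonal_projector_onto N W P" "orthogonal_projector_onto N W Q"
  shows "P = Q"
proof -
  have absorb: "Q * P = P"
    if P: "orthogonal_projector_onto N W P" and Q: "orthogonal_projector_onto N W Q" for P Q
  proof (rule mat_col_eqI)
    have carr: "P \<in> carrier_mat N N" "Q \<in> carrier_mat N N"
      using P Q by (auto simp: orthogonal_projector_onto_def)
    then show "dim_row (Q * P) = dim_row P" "dim_col (Q * P) = dim_col P" by auto
    fix i assume "i < dim_col P"
    then have i: "i < N" using carr by auto
    have "col P i = P *\<^sub>v unit_vec N i"
      using carr i by auto
    then have "col P i \<in> W"
      using P unfolding orthogonal_projector_onto_def by (metis image_eqI unit_vec_carrier)
    then obtain v where v: "v \<in> carrier_vec N" "col P i = Q *\<^sub>v v"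
      using Q unfolding orthogonal_projector_onto_def by blast
    have "col (Q * P) i = Q *\<^sub>v col P i"
      using carr i by (intro col_mult2) auto
    also have "\<dots> = (Q * Q) *\<^sub>v v"
      using carr v by (simp add: assoc_mult_mat_vec[of _ N N _ N])
    also have "\<dots> = col P i"
      using Q v by (simp add: orthogonal_projector_onto_def)
    finally show "col (Q * P) i = col P i" .
  qed
  have "P = mat_adjoint (Q * P)"
    using absorb[OF assms] assms by (simp add: orthogonal_projector_onto_def)
  also have "\<dots> = P * Q"
    using assms by (subst mat_adjoint_mult[of _ N N _ N]) (auto simp: orthogonal_projector_onto_def)
  also have "\<dots> = Q" by (rule absorb[OF assms(2,1)])
  finally show ?thesis .
qed

section \<open>Joint spectral projectors\<close>

text \<open>The spectral content of a context, detached from Heisenberg-Weyl operators: the order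
  condition makes the averages land in eigenspaces, and unitarity makes the joint projectors
  self-adjoint.\<close>

definition commuting_family :: "nat \<Rightarrow> nat \<Rightarrow> complex mat list \<Rightarrow> bool" where
  "commuting_family d N C \<longleftrightarrow>
     (\<forall>A\<in>set C. A \<in> carrier_mat N N \<and> A ^\<^sub>m d = 1\<^sub>m N \<and> mat_adjoint A * A = 1\<^sub>m N) \<and>
     (\<forall>A\<in>set C. \<forall>B\<in>set C. A * B = B * A)"

text \<open>Recursion runs over the operators alone and reads outcomes with \<open>hd\<close> and
  \<open>tl\<close>; the value is meaningful when \<open>s\<close> is as long as the family.\<close>

fun joint_proj :: "nat \<Rightarrow> nat \<Rightarrow> complex mat list \<Rightarrow> int list \<Rightarrow> complex mat" where
  "joint_proj d N [] s = 1\<^sub>m N"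
| "joint_proj d N (A # C) s = spec_proj d N A (hd s) * joint_proj d N C (tl s)"

lemma commuting_familyD:
  assumes "commuting_family d N C" "A \<in> set C"
  shows "A \<in> carrier_mat N N" "A ^\<^sub>m d = 1\<^sub>m N" "mat_adjoint A * A = 1\<^sub>m N"
    and "B \<in> set C \<Longrightarrow> A * B = B * A"
  using assms unfolding commuting_family_def by blast+

lemma commuting_family_Cons:
  "commuting_family d N (A # C) \<Longrightarrow> commuting_family d N C"
  unfolding commuting_family_def by (meson list.set_intros(2))

lemma joint_proj_carrier [simp]: "joint_proj d N C s \<in> carrier_mat N N"
  by (induction C arbitrary: s) (auto intro!: mult_carrier_mat[of _ N N])

text \<open>By commutation the operator passes the factors in front of its own spectral projector,
  where it becomes a scalar.\<close>

lemma joint_proj_eigen: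
  assumes "d > 0" "commuting_family d N C" "i < length C" "length s = length C"
  shows "C ! i * joint_proj d N C s = omega d powi (s ! i) \<cdot>\<^sub>m joint_proj d N C s"
  using assms(2-)
proof (induction C arbitrary: s i)
  case (Cons A C)
  obtain k s' where s: "s = k # s'" using Cons.prems by (cases s) auto
  let ?E = "spec_proj d N A k" and ?P = "joint_proj d N C s'"
  have A: "A \<in> carrier_mat N N" "A ^\<^sub>m d = 1\<^sub>m N"
    using commuting_familyD(1,2)[OF Cons.prems(1)] by auto
  show ?case
  proof (cases i)
    case 0
    have "A * (?E * ?P) = A * ?E * ?P"
      using A by (intro assoc_mult_mat[of _ N N _ N _ N, symmetric]) auto
    then show ?thesis
      using 0 A assms(1) by (simp add: s spec_proj_eigen mult_smult_assoc_mat[of _ N N _ N])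
  next
    case (Suc j)
    have j: "j < length C" using Suc Cons.prems by simp
    have B: "C ! j \<in> carrier_mat N N" "C ! j * A = A * C ! j"
      using nth_mem[OF j] by (auto intro!: commuting_familyD[OF Cons.prems(1)])
    have "C ! j * (?E * ?P) = C ! j * ?E * ?P"
      using B by (intro assoc_mult_mat[of _ N N _ N _ N, symmetric]) auto
    also have "\<dots> = ?E * (C ! j * ?P)"
      unfolding spec_proj_commute[OF A(1) B] using B(1)
      by (intro assoc_mult_mat[of _ N N _ N _ N]) auto
    also have "C ! j * ?P = omega d powi (s' ! j) \<cdot>\<^sub>m ?P"
      using Cons.prems j commuting_family_Cons[OF Cons.prems(1)] by (intro Cons.IH) (auto simp: s)
    finally show ?thesis
      using Suc by (simp add: s mult_smult_distrib[of _ N N _ N])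
  qed
qed simp

text \<open>Each factor fixes Y because the eigenvalues match. Taking the projector itself for Y
  gives idempotence; taking a column shows that common eigenvectors lie in the range.\<close>

lemma joint_proj_mult_eigen:
  assumes "d > 0" "commuting_family d N C" "length s = length C" "Y \<in> carrier_mat N m"
    and "\<And>i. i < length C \<Longrightarrow> C ! i * Y = omega d powi (s ! i) \<cdot>\<^sub>m Y"
  shows "joint_proj d N C s * Y = Y"
  using assms(2-)
proof (induction C arbitrary: s)
  case (Cons A C)
  obtain k s' where s: "s = k # s'" using Cons.prems by (cases s) auto
  have "joint_proj d N C s' * Y = Y"
    using Cons.prems(2,3) Cons.prems(4)[of "Suc _"] commuting_family_Cons[OF Cons.prems(1)]
    by (intro Cons.IH) (auto simp: s)
  moreover have "spec_proj d N A k * Y = Y"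
    using Cons.prems Cons.prems(4)[of 0] assms(1)
    by (subst spec_proj_mult_eigen[of d A N Y m k]) (auto simp: s dest: commuting_familyD(1))
  ultimately show ?case
    using Cons.prems by (simp add: s assoc_mult_mat[of _ N N _ N _ m])
qed simp

lemma mult_joint_proj_eigen:
  assumes "d > 0" "commuting_family d N C" "length s = length C" "X \<in> carrier_mat N N"
    and "\<And>i. i < length C \<Longrightarrow> X * C ! i = omega d powi (s ! i) \<cdot>\<^sub>m X"
  shows "X * joint_proj d N C s = X"
  using assms(2-)
proof (induction C arbitrary: s)
  case (Cons A C)
  obtain k s' where s: "s = k # s'" using Cons.prems by (cases s) auto
  let ?E = "spec_proj d N A k" and ?P = "joint_proj d N C s'"
  have "X * (?E * ?P) = X * ?E * ?P"
    using Cons.prems by (intro assoc_mult_mat[of _ N N _ N _ N, symmetric]) auto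
  also have "X * ?E = X"
    using Cons.prems Cons.prems(4)[of 0] assms(1)
    by (intro mult_spec_proj_eigen) (auto simp: s dest: commuting_familyD(1))
  also have "X * ?P = X"
    using Cons.prems(2,3) Cons.prems(4)[of "Suc _"] commuting_family_Cons[OF Cons.prems(1)]
    by (intro Cons.IH) (auto simp: s)
  finally show ?case by (simp add: s)
qed simp

lemma joint_proj_idem:
  assumes "d > 0" "commuting_family d N C" "length s = length C"
  shows "joint_proj d N C s * joint_proj d N C s = joint_proj d N C s"
  using assms by (intro joint_proj_mult_eigen[of _ _ _ _ _ N]) (auto simp: joint_proj_eigen)

text \<open>With \<open>P\<close> the joint projector, unitarity turns \<open>A * P = c \<cdot>\<^sub>m P\<close> into
  \<open>P\<^sup>* * A = c \<cdot>\<^sub>m P\<^sup>*\<close>. Hence \<open>P\<^sup>* = P\<^sup>* * P\<close>, which is self-adjoint.\<close>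

lemma joint_proj_adjoint:
  assumes "d > 0" "commuting_family d N C" "length s = length C"
  shows "mat_adjoint (joint_proj d N C s) = joint_proj d N C s"
proof -
  define P where "P = joint_proj d N C s"
  have P: "P \<in> carrier_mat N N" "mat_adjoint P \<in> carrier_mat N N" by (simp_all add: P_def)
  have "mat_adjoint P * P = mat_adjoint P"
    unfolding P_def
  proof (rule mult_joint_proj_eigen[OF assms])
    fix i assume i: "i < length C"
    define A where "A = C ! i"
    define c where "c = omega d powi (s ! i)"
    have A: "A \<in> carrier_mat N N" "mat_adjoint A * A = 1\<^sub>m N" "mat_adjoint A \<in> carrier_mat N N"
      using commuting_familyD(1,3)[OF assms(2) nth_mem[OF i]] by (auto simp: A_def)
    have "cnj c * c = 1"
      unfolding c_def cnj_omega_powi by (simp flip: power_int_add)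
    have "P = mat_adjoint A * A * P" using A P by simp
    also have "\<dots> = mat_adjoint A * (A * P)"
      using A P by (intro assoc_mult_mat[of _ N N _ N _ N]) auto
    also have "A * P = c \<cdot>\<^sub>m P"
      unfolding A_def P_def c_def by (rule joint_proj_eigen) (use assms i in auto)
    also have "mat_adjoint A * (c \<cdot>\<^sub>m P) = c \<cdot>\<^sub>m (mat_adjoint A * P)"
      using A P by (intro mult_smult_distrib) auto
    finally have "mat_adjoint P = cnj c \<cdot>\<^sub>m (mat_adjoint (mat_adjoint A * P))"
      by (metis mat_adjoint_smult)
    also have "mat_adjoint (mat_adjoint A * P) = mat_adjoint P * A"
      using A P by (subst mat_adjoint_mult[of _ N N _ N]) auto
    finally have "c \<cdot>\<^sub>m mat_adjoint P = (cnj c * c) \<cdot>\<^sub>m (mat_adjoint P * A)"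
      by (metis smult_smult_mat mult.commute)
    then have "mat_adjoint P * A = c \<cdot>\<^sub>m mat_adjoint P"
      using \<open>cnj c * c = 1\<close> by simp
    then show "mat_adjoint (joint_proj d N C s) * C ! i
        = omega d powi (s ! i) \<cdot>\<^sub>m mat_adjoint (joint_proj d N C s)"
      by (simp add: P_def A_def c_def)
  qed (use P in \<open>simp add: P_def\<close>)
  moreover have "mat_adjoint (mat_adjoint P * P) = mat_adjoint P * P"
    using P by (simp add: mat_adjoint_mult[of _ N N _ N])
  ultimately have "mat_adjoint (mat_adjoint P) = mat_adjoint P" by simp
  then show ?thesis by (simp add: P_def)
qed

section \<open>Identification of the joint projectors with the eigenprojectors\<close>

text \<open>Lets the matrix identities above act on eigenvectors, viewed as one-column
  matrices.\<close>

lemma mult_mat_vec_eq_smult_iff: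
  fixes A :: "complex mat"
  assumes "A \<in> carrier_mat N N" "v \<in> carrier_vec N"
  shows "A *\<^sub>v v = c \<cdot>\<^sub>v v \<longleftrightarrow> A * mat_of_cols N [v] = c \<cdot>\<^sub>m mat_of_cols N [v]"
proof -
  let ?M = "mat_of_cols N [v]"
  have M: "?M \<in> carrier_mat N 1" "col ?M 0 = v"
    using assms by (auto simp: mat_of_cols_carrier)
  have c1: "col (A * ?M) 0 = A *\<^sub>v v"
    using assms M by (subst col_mult2[of _ N N _ 1]) auto
  have c2: "col (c \<cdot>\<^sub>m ?M) 0 = c \<cdot>\<^sub>v v"
    using M by (subst col_smult) auto
  show ?thesis
  proof
    assume "A *\<^sub>v v = c \<cdot>\<^sub>v v"
    then show "A * ?M = c \<cdot>\<^sub>m ?M"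
      using M assms c1 c2 by (intro mat_col_eqI) auto
  qed (use c1 c2 in metis)
qed

text \<open>The eigenvalue equations place the range inside the common eigenspace; conversely a
  common eigenvector is fixed, hence is its own preimage. A zero eigenspace is covered by the same
  argument.\<close>

lemma joint_proj_onto:
  assumes "d > 0" "commuting_family d (d ^ n) C" "length s = length C"
  shows "orthogonal_projector_onto (d ^ n) (common_eigenspace d n C s) (joint_proj d (d ^ n) C s)"
  unfolding orthogonal_projector_onto_def
proof (intro conjI)
  define N where "N = d ^ n"
  let ?P = "joint_proj d (d ^ n) C s"
  have C: "C ! i \<in> carrier_mat N N" if "i < length C" for i
    using commuting_familyD(1)[OF assms(2) nth_mem[OF that]] by (simp add: N_def)
  have P: "?P \<in> carrier_mat N N" by (simp add: N_def)
  show "(*\<^sub>v) ?P ` carrier_vec (d ^ n) = common_eigenspace d n C s"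
  proof (intro equalityI subsetI)
    fix w assume "w \<in> (*\<^sub>v) ?P ` carrier_vec (d ^ n)"
    then obtain v where v: "v \<in> carrier_vec N" "w = ?P *\<^sub>v v" by (auto simp: N_def)
    have "C ! i *\<^sub>v w = omega d powi (s ! i) \<cdot>\<^sub>v w" if i: "i < length C" for i
    proof -
      have "C ! i *\<^sub>v w = (C ! i * ?P) *\<^sub>v v"
        unfolding v(2) using C[OF i] P v(1) by (intro assoc_mult_mat_vec[symmetric]) auto
      also have "C ! i * ?P = omega d powi (s ! i) \<cdot>\<^sub>m ?P"
        using assms i by (intro joint_proj_eigen) auto
      also have "(omega d powi (s ! i) \<cdot>\<^sub>m ?P) *\<^sub>v v = omega d powi (s ! i) \<cdot>\<^sub>v w"
        unfolding v(2) using P v(1) by (intro eq_vecI) auto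
      finally show ?thesis .
    qed
    moreover have "w \<in> carrier_vec N" using P v by simp
    ultimately show "w \<in> common_eigenspace d n C s"
      by (simp add: common_eigenspace_def N_def)
  next
    fix v assume v: "v \<in> common_eigenspace d n C s"
    let ?M = "mat_of_cols N [v]"
    have vc: "v \<in> carrier_vec N" using v by (simp add: common_eigenspace_def N_def)
    have "joint_proj d N C s * ?M = ?M"
    proof (rule joint_proj_mult_eigen)
      show "?M \<in> carrier_mat N 1" using mat_of_cols_carrier(1)[of N "[v]"] by simp
      show "C ! i * ?M = omega d powi (s ! i) \<cdot>\<^sub>m ?M" if "i < length C" for i
        using v that by (subst mult_mat_vec_eq_smult_iff[symmetric, OF C vc])
          (auto simp: common_eigenspace_def)
    qed (use assms in \<open>auto simp: N_def\<close>)
    \<comment> \<open>Being fixed is the eigenvector equation with c = 1.\<close>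
    then have "?P *\<^sub>v v = v"
      using mult_mat_vec_eq_smult_iff[OF P vc, of 1] by (simp add: N_def)
    then show "v \<in> (*\<^sub>v) ?P ` carrier_vec (d ^ n)"
      using vc by (metis N_def image_eqI)
  qed
qed (use assms in \<open>auto simp: joint_proj_idem joint_proj_adjoint\<close>)

lemma eigenprojector_eq_joint_proj:
  assumes "d > 0" "commuting_family d (d ^ n) C" "length s = length C"
  shows "eigenprojector d n C s = joint_proj d (d ^ n) C s"
  unfolding eigenprojector_def
  using joint_proj_onto[OF assms]
  by (intro the_equality) (simp_all add: orthogonal_projector_onto_unique)

section \<open>Outcome tuples, resolutions of the identity and coarse-graining\<close>

lemma Zvec_0 [simp]: "Zvec d 0 = {[]}"
  by (auto simp: Zvec_def)

lemma Zvec_Suc: "Zvec d (Suc m) = case_prod (#) ` (Zmod d \<times> Zvec d m)"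
  by (force simp: Zvec_def length_Suc_conv)

lemma finite_Zmod [simp]: "finite (Zmod d)"
  by (simp add: Zmod_def)

lemma finite_Zvec [simp]: "finite (Zvec d m)"
  by (induction m) (simp_all add: Zvec_Suc)

text \<open>An outcome of \<open>A # C\<close> is a pair of an outcome of A and one of C, so the sum
  factors into two resolutions of the identity.\<close>

lemma sum_joint_proj:
  assumes "d > 0" "commuting_family d N C"
  shows "mat_sum N (joint_proj d N C) (Zvec d (length C)) = 1\<^sub>m N"
  using assms(2)
proof (induction C)
  case Nil
  then show ?case by (intro eq_matI) auto
next
  case (Cons A C)
  have A: "A \<in> carrier_mat N N" using commuting_familyD(1)[OF Cons.prems] by simp
  have "mat_sum N (joint_proj d N (A # C)) (Zvec d (length (A # C)))
    = mat_sum N (\<lambda>(k, s). spec_proj d N A k * joint_proj d N C s) (Zmod d \<times> Zvec d (length C))"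
    by (rule eq_matI)
      (simp_all add: Zvec_Suc sum.reindex inj_on_def case_prod_unfold del: index_mult_mat(1))
  also have "\<dots> = mat_sum N (\<lambda>k. spec_proj d N A k * mat_sum N (joint_proj d N C) (Zvec d (length C))) (Zmod d)"
    by (rule eq_matI)
      (simp_all add: mult_mat_sum sum.cartesian_product case_prod_unfold del: index_mult_mat(1))
  also have "\<dots> = 1\<^sub>m N"
    using Cons commuting_family_Cons[OF Cons.prems] sum_spec_proj[OF assms(1) A]
    by (simp add: right_mult_one_mat[of _ N N])
  finally show ?case .
qed

text \<open>Insert the resolution of the identity given by C: T is a scalar on each joint
  eigenspace, and its spectral projector keeps exactly those with the matching eigenvalue. T may lie
  outside C, as the product T_u T_v does.\<close>

lemma spec_proj_eq_sum_joint_proj: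
  assumes "d > 0" "commuting_family d N C" "T \<in> carrier_mat N N"
    and f: "\<And>t. t \<in> Zvec d (length C) \<Longrightarrow> f t \<in> Zmod d"
    and T: "\<And>t. t \<in> Zvec d (length C) \<Longrightarrow>
      T * joint_proj d N C t = omega d powi (f t) \<cdot>\<^sub>m joint_proj d N C t"
    and "k \<in> Zmod d"
  shows "spec_proj d N T k = mat_sum N (joint_proj d N C) {t \<in> Zvec d (length C). f t = k}"
proof -
  let ?Z = "Zvec d (length C)"
  \<comment> \<open>Both numbers are residues in {0..<d}, where congruence is equality.\<close>
  have eq: "int d dvd f t - k \<longleftrightarrow> f t = k" if "t \<in> ?Z" for t
    using f[OF that] \<open>k \<in> Zmod d\<close>
    by (auto simp: Zmod_def mod_eq_dvd_iff[symmetric] mod_pos_pos_trivial)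
  have "spec_proj d N T k = spec_proj d N T k * mat_sum N (joint_proj d N C) ?Z"
    by (simp add: sum_joint_proj[OF assms(1,2)])
  also have "\<dots> = mat_sum N (\<lambda>t. spec_proj d N T k * joint_proj d N C t) ?Z"
    by (simp add: mult_mat_sum)
  also have "\<dots> = mat_sum N (\<lambda>t. if f t = k then joint_proj d N C t else 0\<^sub>m N N) ?Z"
    using T eq assms(1,3) by (intro mat_sum_cong) (simp add: spec_proj_mult_eigen[of _ _ _ _ N])
  also have "\<dots> = mat_sum N (joint_proj d N C) {t \<in> ?Z. f t = k}"
    by (rule eq_matI) (auto simp: sum.If_cases if_distrib[of "\<lambda>M. M $$ _"] Int_def
       intro!: sum.mono_neutral_cong_right)
  finally show ?thesis .
qed

lemma sum_omega_spec_proj: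
  assumes "d > 0" "T \<in> carrier_mat N N" "T ^\<^sub>m d = 1\<^sub>m N"
  shows "T = mat_sum N (\<lambda>k. omega d powi k \<cdot>\<^sub>m spec_proj d N T k) (Zmod d)"
proof -
  have "T = T * mat_sum N (spec_proj d N T) (Zmod d)"
    using assms by (simp add: sum_spec_proj)
  also have "\<dots> = mat_sum N (\<lambda>k. omega d powi k \<cdot>\<^sub>m spec_proj d N T k) (Zmod d)"
    using assms by (simp add: mult_mat_sum spec_proj_eigen)
  finally show ?thesis .
qed

section \<open>Kronecker products\<close>

lemma kron_dim [simp]:
  "dim_row (kron A B) = dim_row A * dim_row B" "dim_col (kron A B) = dim_col A * dim_col B"
  by (simp_all add: kron_def)

lemma kron_carrier:
  "A \<in> carrier_mat a b \<Longrightarrow> B \<in> carrier_mat c e \<Longrightarrow> kron A B \<in> carrier_mat (a * c) (b * e)"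
  by (rule carrier_matI) auto

lemma kron_index:
  assumes "A \<in> carrier_mat a b" "B \<in> carrier_mat c e" "i < a * c" "j < b * e"
  shows "kron A B $$ (i, j) = A $$ (i div c, j div e) * B $$ (i mod c, j mod e)"
  using assms by (auto simp: kron_def)

text \<open>The index convention k = x * b + y as a bijection; it splits the contracted index of a
  product of Kronecker products.\<close>

lemma sum_div_mod:
  fixes f :: "nat \<Rightarrow> nat \<Rightarrow> 'a :: comm_monoid_add"
  shows "(\<Sum>k<a * b. f (k div b) (k mod b)) = (\<Sum>x<a. \<Sum>y<b. f x y)"
proof (cases "b = 0")
  case False
  have "(\<Sum>x<a. \<Sum>y<b. f x y) = (\<Sum>(x, y)\<in>{..<a} \<times> {..<b}. f x y)"
    by (rule sum.cartesian_product)
  also have "\<dots> = (\<Sum>k<a * b. f (k div b) (k mod b))"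
  proof (rule sum.reindex_bij_witness[of _ "\<lambda>k. (k div b, k mod b)" "\<lambda>(x, y). x * b + y"])
    fix z assume "z \<in> {..<a} \<times> {..<b}"
    then obtain x y where z: "z = (x, y)" "x < a" "y < b" by auto
    have "x * b + y < Suc x * b" using z by simp
    also have "\<dots> \<le> a * b" using z by (intro mult_le_mono1) simp
    finally show "(case z of (x, y) \<Rightarrow> x * b + y) \<in> {..<a * b}" by (simp add: z)
  qed (use False in \<open>auto simp: less_mult_imp_div_less\<close>)
  finally show ?thesis by simp
qed simp

lemma div_mod_less_mult:
  fixes i :: nat
  assumes "i < a * b"
  shows "i div b < a" "i mod b < b"
proof -
  have "b > 0" using assms by (cases b) auto
  then show "i div b < a" "i mod b < b" using assms by (auto simp: less_mult_imp_div_less)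
qed

text \<open>The mixed-product property: once the contracted index is split into quotient and
  remainder, the sum is a product of two sums.\<close>

lemma kron_mult:
  assumes "A \<in> carrier_mat a b" "A' \<in> carrier_mat b c" "B \<in> carrier_mat e f" "B' \<in> carrier_mat f g"
  shows "kron A B * kron A' B' = kron (A * A') (B * B')"
proof (rule eq_matI)
  fix i j assume "i < dim_row (kron (A * A') (B * B'))" "j < dim_col (kron (A * A') (B * B'))"
  then have ij: "i < a * e" "j < c * g" using assms by auto
  note dm = div_mod_less_mult[OF ij(1)] div_mod_less_mult[OF ij(2)]
  have "(kron A B * kron A' B') $$ (i, j) = (\<Sum>k<b * f. kron A B $$ (i, k) * kron A' B' $$ (k, j))"
    using assms ij by (intro mat_mult_index kron_carrier) auto
  also have "\<dots> = (\<Sum>k<b * f. (A $$ (i div e, k div f) * A' $$ (k div f, j div g)) *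
      (B $$ (i mod e, k mod f) * B' $$ (k mod f, j mod g)))"
    using assms ij
    by (intro sum.cong) (simp_all add: kron_index[of A a b B e f] kron_index[of A' b c B' f g] mult_ac)
  also have "\<dots> = (\<Sum>x<b. \<Sum>y<f. (A $$ (i div e, x) * A' $$ (x, j div g)) *
      (B $$ (i mod e, y) * B' $$ (y, j mod g)))"
    by (rule sum_div_mod)
  also have "\<dots> = (A * A') $$ (i div e, j div g) * (B * B') $$ (i mod e, j mod g)"
    unfolding mat_mult_index[OF assms(1,2) dm(1) dm(3)] mat_mult_index[OF assms(3,4) dm(2) dm(4)]
    by (simp add: sum_product)
  also have "\<dots> = kron (A * A') (B * B') $$ (i, j)"
    using assms ij by (intro kron_index[symmetric]) auto
  finally show "(kron A B * kron A' B') $$ (i, j) = kron (A * A') (B * B') $$ (i, j)" .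
qed (use assms in auto)

lemma kron_smult:
  "kron (x \<cdot>\<^sub>m A) (y \<cdot>\<^sub>m B) = (x * y) \<cdot>\<^sub>m kron A B"
proof (rule eq_matI)
  fix i j assume "i < dim_row ((x * y) \<cdot>\<^sub>m kron A B)" "j < dim_col ((x * y) \<cdot>\<^sub>m kron A B)"
  then have ij: "i < dim_row A * dim_row B" "j < dim_col A * dim_col B" by auto
  then show "kron (x \<cdot>\<^sub>m A) (y \<cdot>\<^sub>m B) $$ (i, j) = ((x * y) \<cdot>\<^sub>m kron A B) $$ (i, j)"
    using div_mod_less_mult[OF ij(1)] div_mod_less_mult[OF ij(2)] by (simp add: kron_def)
qed auto

lemma kron_adjoint: "mat_adjoint (kron A B) = kron (mat_adjoint A) (mat_adjoint B)"
proof (rule eq_matI)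
  fix i j assume "i < dim_row (kron (mat_adjoint A) (mat_adjoint B))"
    "j < dim_col (kron (mat_adjoint A) (mat_adjoint B))"
  then have ij: "i < dim_col A * dim_col B" "j < dim_row A * dim_row B" by auto
  then show "mat_adjoint (kron A B) $$ (i, j) = kron (mat_adjoint A) (mat_adjoint B) $$ (i, j)"
    using div_mod_less_mult[OF ij(1)] div_mod_less_mult[OF ij(2)] by (simp add: kron_def)
qed auto

lemma kron_one: "kron (1\<^sub>m a) (1\<^sub>m b) = 1\<^sub>m (a * b)"
proof (rule eq_matI)
  fix i j assume "i < dim_row (1\<^sub>m (a * b) :: complex mat)" "j < dim_col (1\<^sub>m (a * b) :: complex mat)"
  then have ij: "i < a * b" "j < a * b" by auto
  have "i div b = j div b \<and> i mod b = j mod b \<longleftrightarrow> i = j" by (metis div_mult_mod_eq)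
  then show "kron (1\<^sub>m a) (1\<^sub>m b) $$ (i, j) = 1\<^sub>m (a * b) $$ (i, j)"
    using ij div_mod_less_mult[OF ij(1)] div_mod_less_mult[OF ij(2)] by (auto simp: kron_def)
qed auto

lemma kron_list_Nil [simp]: "kron_list [] = 1\<^sub>m 1"
  and kron_list_Cons [simp]: "kron_list (A # As) = kron A (kron_list As)"
  by (simp_all add: kron_list_def)

lemma kron_list_carrier:
  assumes "set As \<subseteq> carrier_mat d d" "length As = n"
  shows "kron_list As \<in> carrier_mat (d ^ n) (d ^ n)"
  using assms
proof (induction As arbitrary: n)
  case (Cons A As)
  then show ?case by (cases n) (auto intro!: kron_carrier)
qed auto

lemma kron_list_map_mult:
  assumes "length a = length b" "\<And>x. F x \<in> carrier_mat d d" "\<And>x. G x \<in> carrier_mat d d"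
  shows "kron_list (map F a) * kron_list (map G b) = kron_list (map2 (\<lambda>x y. F x * G y) a b)"
  using assms(1)
proof (induction a b rule: list_induct2)
  case (Cons x xs y ys)
  have "kron_list (map F xs) \<in> carrier_mat (d ^ length xs) (d ^ length xs)"
    "kron_list (map G ys) \<in> carrier_mat (d ^ length xs) (d ^ length xs)"
    using assms Cons.hyps by (auto intro!: kron_list_carrier)
  then show ?case
    using assms(2)[of x] assms(3)[of y] Cons.IH by (simp add: kron_mult[of _ d d _ d])
qed simp

lemma kron_list_unitary:
  assumes "\<And>A. A \<in> set As \<Longrightarrow> A \<in> carrier_mat d d \<and> mat_adjoint A * A = 1\<^sub>m d" "length As = n"
  shows "mat_adjoint (kron_list As) * kron_list As = 1\<^sub>m (d ^ n)"
  using assms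
proof (induction As arbitrary: n)
  case (Cons A As)
  have "kron_list As \<in> carrier_mat (d ^ length As) (d ^ length As)"
    using Cons.prems by (intro kron_list_carrier) auto
  then show ?case
    using Cons.IH[of "length As"] Cons.prems
    by (auto simp: kron_adjoint kron_mult[of _ d d _ d _ "d ^ length As" "d ^ length As"] kron_one)
qed simp

section \<open>Heisenberg-Weyl operators\<close>

lemma pauli_X_carrier [simp]: "pauli_X d \<in> carrier_mat d d"
  and pauli_Z_carrier [simp]: "pauli_Z d \<in> carrier_mat d d"
  by (simp_all add: pauli_X_def pauli_Z_def)

lemma mod_add_eq_iff:
  fixes i j k d :: nat
  assumes "i < d" "j < d"
  shows "(i + k) mod d = (j + k) mod d \<longleftrightarrow> i = j"
  using assms cong_add_rcancel_nat[of i k j d] by (auto simp: cong_def)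

lemma pauli_X_pow: "pauli_X d ^\<^sub>m k = mat d d (\<lambda>(i, j). if i = (j + k) mod d then 1 else 0)"
proof (induction k)
  case 0
  then show ?case by (intro eq_matI) (auto simp: pauli_X_def)
next
  case (Suc k)
  show ?case
  proof (rule eq_matI)
    fix i j assume "i < dim_row (mat d d (\<lambda>(i, j). if i = (j + Suc k) mod d then 1 else 0 :: complex))"
      "j < dim_col (mat d d (\<lambda>(i, j). if i = (j + Suc k) mod d then 1 else 0 :: complex))"
    then have ij: "i < d" "j < d" by auto
    have "(pauli_X d ^\<^sub>m Suc k) $$ (i, j)
      = (\<Sum>l<d. (pauli_X d ^\<^sub>m k) $$ (i, l) * pauli_X d $$ (l, j))"
      using ij by (subst pow_mat.simps, intro mat_mult_index[of _ d d _ d]) auto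
    also have "\<dots> = (\<Sum>l<d. if l = (j + 1) mod d then (if i = (l + k) mod d then 1 else 0) else 0)"
      unfolding Suc using ij by (intro sum.cong) (auto simp: pauli_X_def)
    also have "\<dots> = (if i = ((j + 1) mod d + k) mod d then 1 else 0)"
      using ij by simp
    finally show "(pauli_X d ^\<^sub>m Suc k) $$ (i, j)
      = mat d d (\<lambda>(i, j). if i = (j + Suc k) mod d then 1 else 0) $$ (i, j)"
      using ij by (simp add: mod_simps)
  qed (auto simp: pauli_X_def)
qed

lemma pauli_Z_pow: "pauli_Z d ^\<^sub>m k = mat d d (\<lambda>(i, j). if i = j then omega d ^ (i * k) else 0)"
proof (induction k)
  case 0
  then show ?case by (intro eq_matI) (auto simp: pauli_Z_def)
next
  case (Suc k)
  show ?case
  proof (rule eq_matI)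
    fix i j assume "i < dim_row (mat d d (\<lambda>(i, j). if i = j then omega d ^ (i * Suc k) else 0))"
      "j < dim_col (mat d d (\<lambda>(i, j). if i = j then omega d ^ (i * Suc k) else 0))"
    then have ij: "i < d" "j < d" by auto
    have "(pauli_Z d ^\<^sub>m Suc k) $$ (i, j)
      = (\<Sum>l<d. (pauli_Z d ^\<^sub>m k) $$ (i, l) * pauli_Z d $$ (l, j))"
      using ij by (subst pow_mat.simps, intro mat_mult_index[of _ d d _ d]) auto
    also have "\<dots> = (\<Sum>l<d. if l = j then (if i = l then omega d ^ (i * Suc k) else 0) else 0)"
      unfolding Suc using ij by (intro sum.cong) (auto simp: pauli_Z_def power_add mult.commute)
    finally show "(pauli_Z d ^\<^sub>m Suc k) $$ (i, j)
      = mat d d (\<lambda>(i, j). if i = j then omega d ^ (i * Suc k) else 0) $$ (i, j)"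
      using ij by simp
  qed (auto simp: pauli_Z_def)
qed

lemma pow_mat_add:
  fixes A :: "'a :: semiring_1 mat"
  assumes "A \<in> carrier_mat n n"
  shows "A ^\<^sub>m (j + k) = A ^\<^sub>m j * A ^\<^sub>m k"
proof (induction k)
  case (Suc k)
  then show ?case using assms by (simp add: assoc_mult_mat[of _ n n _ n _ n])
qed (use assms in simp)

lemma pauli_X_pow_mod: "pauli_X d ^\<^sub>m (k mod d) = pauli_X d ^\<^sub>m k"
  by (simp add: pauli_X_pow mod_simps)

lemma pauli_Z_pow_mod: "pauli_Z d ^\<^sub>m (k mod d) = pauli_Z d ^\<^sub>m k"
proof -
  have "omega d ^ (i * (k mod d)) = omega d ^ (i * k)" if "i < d" for i
  proof -
    have "omega d powi int (i * (k mod d)) = omega d powi int (i * k)"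
      using that by (intro omega_powi_cong) (auto simp: zmod_int mod_mult_right_eq)
    then show ?thesis by (simp only: power_int_of_nat)
  qed
  then show ?thesis by (auto simp: pauli_Z_pow intro!: eq_matI)
qed

text \<open>The Weyl commutation relation. Applied to |j>, the left product takes its phase
  omega^(ja) before the shift by b, the reversed product takes omega^((j+b)a) after it.\<close>

lemma pauli_X_pow_mult_pauli_Z_pow:
  "pauli_X d ^\<^sub>m b * pauli_Z d ^\<^sub>m a
    = omega d powi (- (int a * int b)) \<cdot>\<^sub>m (pauli_Z d ^\<^sub>m a * pauli_X d ^\<^sub>m b)" (is "?l = ?r")
proof (rule eq_matI)
  fix i j assume "i < dim_row ?r" "j < dim_col ?r"
  then have ij: "i < d" "j < d" by (auto simp: pauli_X_def pauli_Z_def split: if_splits)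
  have Xc: "pauli_X d ^\<^sub>m b \<in> carrier_mat d d" and Zc: "pauli_Z d ^\<^sub>m a \<in> carrier_mat d d" by auto
  have "?l $$ (i, j) = (\<Sum>l<d. (pauli_X d ^\<^sub>m b) $$ (i, l) * (pauli_Z d ^\<^sub>m a) $$ (l, j))"
    using ij by (intro mat_mult_index[OF Xc Zc])
  also have "\<dots> = (\<Sum>l<d. if l = j then (if i = (j + b) mod d then omega d ^ (j * a) else 0) else 0)"
    using ij by (intro sum.cong) (auto simp: pauli_X_pow pauli_Z_pow)
  finally have l: "?l $$ (i, j) = (if i = (j + b) mod d then omega d ^ (j * a) else 0)"
    using ij by simp
  have "?r $$ (i, j) = omega d powi (- (int a * int b)) * (pauli_Z d ^\<^sub>m a * pauli_X d ^\<^sub>m b) $$ (i, j)"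
    using ij by (intro index_smult_mat(1)) (simp_all add: pauli_X_def pauli_Z_def)
  also have "(pauli_Z d ^\<^sub>m a * pauli_X d ^\<^sub>m b) $$ (i, j)
    = (\<Sum>l<d. (pauli_Z d ^\<^sub>m a) $$ (i, l) * (pauli_X d ^\<^sub>m b) $$ (l, j))"
    using ij by (intro mat_mult_index[OF Zc Xc])
  also have "\<dots> = (\<Sum>l<d. if l = i then (if i = (j + b) mod d then omega d ^ (i * a) else 0) else 0)"
    using ij by (intro sum.cong) (auto simp: pauli_X_pow pauli_Z_pow)
  finally have r: "?r $$ (i, j)
      = omega d powi (- (int a * int b)) * (if i = (j + b) mod d then omega d ^ (i * a) else 0)"
    using ij by simp
  \<comment> \<open>The shifted index is reduced mod d; the carry \<open>(j + b) div d\<close>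
    changes the exponent by a multiple of d.\<close>
  have "omega d powi int (j * a) = omega d powi (- (int a * int b) + int ((j + b) mod d * a))"
  proof (rule omega_powi_cong)
    have "int (j + b) = int d * int ((j + b) div d) + int ((j + b) mod d)"
      by (simp only: flip: of_nat_mult of_nat_add) simp
    then have "int (j + b) * int a = (int d * int ((j + b) div d) + int ((j + b) mod d)) * int a"
      by simp
    then have "int (j * a) - (- (int a * int b) + int ((j + b) mod d * a))
        = int d * (int ((j + b) div d) * int a)"
      by (simp add: algebra_simps)
    then show "int (j * a) mod int d = (- (int a * int b) + int ((j + b) mod d * a)) mod int d"
      unfolding mod_eq_dvd_iff by (rule dvdI)
  qed (use ij in simp)
  also have "\<dots> = omega d powi (- (int a * int b)) * omega d powi int ((j + b) mod d * a)"
    by (rule power_int_add) simp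
  finally have "omega d ^ (j * a) = omega d powi (- (int a * int b)) * omega d ^ ((j + b) mod d * a)"
    by (simp only: power_int_of_nat)
  then show "?l $$ (i, j) = ?r $$ (i, j)" unfolding l r by simp
qed (simp_all add: pauli_X_def pauli_Z_def)

lemma pauli_unitary:
  assumes "d > 0"
  shows "mat_adjoint (pauli_X d) * pauli_X d = 1\<^sub>m d"
    and "mat_adjoint (pauli_Z d) * pauli_Z d = 1\<^sub>m d"
proof -
  show "mat_adjoint (pauli_X d) * pauli_X d = 1\<^sub>m d"
  proof (rule eq_matI)
    fix i j assume "i < dim_row (1\<^sub>m d :: complex mat)" "j < dim_col (1\<^sub>m d :: complex mat)"
    then have ij: "i < d" "j < d" by auto
    have "(mat_adjoint (pauli_X d) * pauli_X d) $$ (i, j)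
      = (\<Sum>l<d. mat_adjoint (pauli_X d) $$ (i, l) * pauli_X d $$ (l, j))"
      using ij by (intro mat_mult_index[of _ d d _ d]) auto
    also have "\<dots> = (\<Sum>l<d. if l = (j + 1) mod d then (if i = j then 1 else 0) else 0)"
      using ij mod_add_eq_iff[OF ij, of 1]
      by (intro sum.cong) (auto simp: pauli_X_def)
    finally show "(mat_adjoint (pauli_X d) * pauli_X d) $$ (i, j) = 1\<^sub>m d $$ (i, j)"
      using ij by simp
  qed (auto simp: pauli_X_def)
  show "mat_adjoint (pauli_Z d) * pauli_Z d = 1\<^sub>m d"
  proof (rule eq_matI)
    fix i j assume "i < dim_row (1\<^sub>m d :: complex mat)" "j < dim_col (1\<^sub>m d :: complex mat)"
    then have ij: "i < d" "j < d" by auto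
    have unit: "cnj (omega d ^ j) * omega d ^ j = 1"
      using cnj_omega_powi[of d "int j"] by (simp add: power_int_minus)
    have "(mat_adjoint (pauli_Z d) * pauli_Z d) $$ (i, j)
      = (\<Sum>l<d. mat_adjoint (pauli_Z d) $$ (i, l) * pauli_Z d $$ (l, j))"
      using ij by (intro mat_mult_index[of _ d d _ d]) auto
    also have "\<dots> = (\<Sum>l<d. if l = j then (if i = j then 1 else 0) else 0)"
      using ij unit by (intro sum.cong) (auto simp: pauli_Z_def)
    finally show "(mat_adjoint (pauli_Z d) * pauli_Z d) $$ (i, j) = 1\<^sub>m d $$ (i, j)"
      using ij by simp
  qed (auto simp: pauli_Z_def)
qed

section \<open>The inner product and addition modulo d\<close>

lemma dot_commute:
  assumes "length a = length b"
  shows "dot d a b = dot d b a"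
proof -
  have "(\<Sum>(x, y)\<leftarrow>zip a b. x * y) = (\<Sum>(x, y)\<leftarrow>zip b a. x * y)"
    using assms by (induction a b rule: list_induct2) (auto simp: mult.commute)
  then show ?thesis by (simp add: dot_def)
qed

lemma length_Zvec_add [simp]: "length (Zvec_add d a b) = min (length a) (length b)"
  by (simp add: Zvec_add_def)

text \<open>A congruence and not an equation, since the sum of two residues on the right is left
  unreduced.\<close>

lemma dot_add_left:
  assumes "length a = length b" "length b = length c"
  shows "[dot d (Zvec_add d a b) c = dot d a c + dot d b c] (mod int d)"
proof -
  have "[(\<Sum>(x, y)\<leftarrow>zip (Zvec_add d a b) c. x * y)
      = (\<Sum>(x, y)\<leftarrow>zip a c. x * y) + (\<Sum>(x, y)\<leftarrow>zip b c. x * y)] (mod int d)"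
    using assms
  proof (induction a b c rule: list_induct3)
    case (Cons x xs y ys z zs)
    have "[(x + y) mod int d * z = (x + y) * z] (mod int d)"
      by (intro cong_mult) (simp_all add: cong_def)
    from cong_add[OF this Cons.IH] show ?case
      by (simp add: Zvec_add_def algebra_simps)
  qed (simp add: Zvec_add_def)
  then show ?thesis by (simp add: dot_def cong_def mod_simps)
qed

lemma dot_add_right:
  assumes "length a = length b" "length b = length c"
  shows "[dot d c (Zvec_add d a b) = dot d c a + dot d c b] (mod int d)"
  using dot_add_left[OF assms, of d] assms
  by (simp add: dot_commute[of c])

lemma Zvec_add_closed:
  assumes "d > 0" "a \<in> Zvec d n" "b \<in> Zvec d n"
  shows "Zvec_add d a b \<in> Zvec d n"
  using assms by (auto simp: Zvec_def Zvec_add_def Zmod_def)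

lemma phase_add_closed:
  assumes "d > 0" "u \<in> phase_space d n" "v \<in> phase_space d n"
  shows "phase_add d u v \<in> phase_space d n"
  using assms by (auto simp: phase_space_def phase_add_def Zvec_add_closed)

lemma phase_add_commute: "phase_add d u v = phase_add d v u"
proof -
  have "Zvec_add d a b = Zvec_add d b a" for a b
    unfolding Zvec_add_def
    by (rule nth_equalityI) (auto simp: add.commute)
  then show ?thesis by (simp add: phase_add_def)
qed

section \<open>Tensor products of Pauli matrices\<close>

lemma pauli_vec_carrier:
  assumes "length a = n"
  shows "pauli_X_vec d a \<in> carrier_mat (d ^ n) (d ^ n)" "pauli_Z_vec d a \<in> carrier_mat (d ^ n) (d ^ n)"
  using assms unfolding pauli_X_vec_def pauli_Z_vec_def by (auto intro!: kron_list_carrier)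

text \<open>Stated for any A whose powers have period d, to serve both X and Z; the period absorbs
  the reductions made by \<open>Zvec_add\<close>.\<close>

lemma kron_list_pow_add:
  assumes A: "A \<in> carrier_mat d d" "\<And>k. A ^\<^sub>m (k mod d) = A ^\<^sub>m k"
    and ab: "a \<in> Zvec d n" "b \<in> Zvec d n"
  shows "kron_list (map (\<lambda>x. A ^\<^sub>m nat x) a) * kron_list (map (\<lambda>x. A ^\<^sub>m nat x) b)
    = kron_list (map (\<lambda>x. A ^\<^sub>m nat x) (Zvec_add d a b))"
proof -
  have "A ^\<^sub>m nat x * A ^\<^sub>m nat y = A ^\<^sub>m nat ((x + y) mod int d)"
    if "x \<in> Zmod d" "y \<in> Zmod d" for x y
  proof -
    have "nat ((x + y) mod int d) = (nat x + nat y) mod d"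
      using that by (simp add: Zmod_def nat_mod_distrib nat_add_distrib)
    then show ?thesis using A by (simp add: pow_mat_add)
  qed
  then have "map2 (\<lambda>x y. A ^\<^sub>m nat x * A ^\<^sub>m nat y) a b = map (\<lambda>x. A ^\<^sub>m nat x) (Zvec_add d a b)"
    unfolding Zvec_add_def map_map comp_def
    using ab set_zip_leftD[of _ _ a b] set_zip_rightD[of _ _ a b]
    by (intro map_cong refl) (force simp: Zvec_def subset_iff)
  then show ?thesis
    using ab A(1) by (subst kron_list_map_mult[of a b _ d]) (auto simp: Zvec_def)
qed

text \<open>The commutation phases of the tensor factors multiply. Entries are nonnegative so that
  \<open>nat\<close> preserves the exponents.\<close>

lemma pauli_X_vec_mult_pauli_Z_vec:
  assumes "d > 0" "length a = length b" "\<forall>x\<in>set a. 0 \<le> x" "\<forall>x\<in>set b. 0 \<le> x"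
  shows "pauli_X_vec d b * pauli_Z_vec d a
    = omega d powi (- dot d a b) \<cdot>\<^sub>m (pauli_Z_vec d a * pauli_X_vec d b)"
proof -
  \<comment> \<open>The induction carries the unreduced exponent, which is additive in the list;
    passing to \<open>dot\<close> is a single reduction at the end.\<close>
  have "pauli_X_vec d b * pauli_Z_vec d a
    = omega d powi (- (\<Sum>(x, y)\<leftarrow>zip a b. x * y)) \<cdot>\<^sub>m (pauli_Z_vec d a * pauli_X_vec d b)"
    using assms(2-)
  proof (induction a b rule: list_induct2)
    case Nil
    then show ?case by (simp add: pauli_X_vec_def pauli_Z_vec_def)
  next
    case (Cons x xs y ys)
    let ?X = "pauli_X d ^\<^sub>m nat y" and ?Z = "pauli_Z d ^\<^sub>m nat x"
    let ?Xs = "pauli_X_vec d ys" and ?Zs = "pauli_Z_vec d xs"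
    have c: "?X \<in> carrier_mat d d" "?Z \<in> carrier_mat d d"
      "?Xs \<in> carrier_mat (d ^ length xs) (d ^ length xs)"
      "?Zs \<in> carrier_mat (d ^ length xs) (d ^ length xs)"
      using Cons.hyps by (auto intro!: pauli_vec_carrier)
    have "pauli_X_vec d (y # ys) * pauli_Z_vec d (x # xs) = kron ?X ?Xs * kron ?Z ?Zs"
      by (simp add: pauli_X_vec_def pauli_Z_vec_def)
    also have "\<dots> = kron (?X * ?Z) (?Xs * ?Zs)"
      by (rule kron_mult[OF c(1,2,3,4)])
    also have "?X * ?Z = omega d powi (- (x * y)) \<cdot>\<^sub>m (?Z * ?X)"
      using Cons.prems by (subst pauli_X_pow_mult_pauli_Z_pow) simp
    also have "?Xs * ?Zs = omega d powi (- (\<Sum>(x, y)\<leftarrow>zip xs ys. x * y)) \<cdot>\<^sub>m (?Zs * ?Xs)"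
      using Cons by simp
    also have "kron (omega d powi (- (x * y)) \<cdot>\<^sub>m (?Z * ?X))
        (omega d powi (- (\<Sum>(x, y)\<leftarrow>zip xs ys. x * y)) \<cdot>\<^sub>m (?Zs * ?Xs))
      = omega d powi (- (\<Sum>(x, y)\<leftarrow>zip (x # xs) (y # ys). x * y)) \<cdot>\<^sub>m kron (?Z * ?X) (?Zs * ?Xs)"
      unfolding kron_smult by (simp flip: power_int_add)
    also have "kron (?Z * ?X) (?Zs * ?Xs) = kron ?Z ?Zs * kron ?X ?Xs"
      by (rule kron_mult[OF c(2,1,4,3), symmetric])
    finally show ?case by (simp add: pauli_X_vec_def pauli_Z_vec_def)
  qed
  also have "omega d powi (- (\<Sum>(x, y)\<leftarrow>zip a b. x * y)) = omega d powi (- dot d a b)"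
    by (rule omega_powi_cong) (simp_all add: dot_def assms(1) mod_minus_eq)
  finally show ?thesis .
qed

section \<open>Unitarity and multiplication of Heisenberg-Weyl operators\<close>

lemma weyl_carrier:
  assumes "u \<in> phase_space d n"
  shows "weyl d u \<in> carrier_mat (d ^ n) (d ^ n)"
proof -
  have "length (fst u) = n" "length (snd u) = n"
    using assms by (auto simp: phase_space_def Zvec_def)
  then have "pauli_Z_vec d (fst u) * pauli_X_vec d (snd u) \<in> carrier_mat (d ^ n) (d ^ n)"
    by (intro mult_carrier_mat[of _ _ "d ^ n"] pauli_vec_carrier)
  then show ?thesis by (simp only: weyl_def smult_carrier_mat)
qed

lemma weyl_unitary:
  assumes "d > 0" "u \<in> phase_space d n"
  shows "mat_adjoint (weyl d u) * weyl d u = 1\<^sub>m (d ^ n)"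
proof -
  obtain a b where u: "u = (a, b)" by (cases u)
  have len: "length a = n" "length b = n" using assms by (auto simp: u phase_space_def Zvec_def)
  let ?Z = "pauli_Z_vec d a" and ?X = "pauli_X_vec d b"
  note c = pauli_vec_carrier(2)[OF len(1), of d] pauli_vec_carrier(1)[OF len(2), of d]
  define w where "w = omega d powi (- (modular_inverse (int d) 2 * dot d a b))"
  have w: "cnj w * w = 1"
    unfolding w_def cnj_omega_powi by (simp flip: power_int_add)
  have "mat_adjoint ?Z * ?Z = 1\<^sub>m (d ^ n)" "mat_adjoint ?X * ?X = 1\<^sub>m (d ^ n)"
    unfolding pauli_X_vec_def pauli_Z_vec_def
    by (rule kron_list_unitary;
        auto simp: len intro!: mat_adjoint_pow_mult_pow pauli_unitary assms(1) pow_carrier_mat)+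
  then have ZX: "mat_adjoint (?Z * ?X) * (?Z * ?X) = 1\<^sub>m (d ^ n)"
    by (intro mat_adjoint_mult_one_mult c)
  have cc: "?Z * ?X \<in> carrier_mat (d ^ n) (d ^ n)" using c by (rule mult_carrier_mat)
  have "mat_adjoint (weyl d u) * weyl d u
    = (cnj w \<cdot>\<^sub>m mat_adjoint (?Z * ?X)) * (w \<cdot>\<^sub>m (?Z * ?X))"
    by (simp add: weyl_def u w_def mat_adjoint_smult)
  also have "\<dots> = (cnj w * w) \<cdot>\<^sub>m (mat_adjoint (?Z * ?X) * (?Z * ?X))"
    using cc by (subst mult_smult_assoc_mat[of _ "d ^ n" "d ^ n" _ "d ^ n"])
      (auto simp: mult_smult_distrib[of _ "d ^ n" "d ^ n" _ "d ^ n"] smult_smult_mat)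
  finally show ?thesis by (simp add: w ZX)
qed

text \<open>Moving X^b past Z^a' costs the phase exponent -(a'|b). The exponent of T_{u+v} contains
  instead minus half of the cross terms (a|b') + (a'|b). These agree when [u, v] = 0, so half their
  sum is exactly (a'|b).\<close>

lemma weyl_mult:
  assumes "odd d" "u \<in> phase_space d n" "v \<in> phase_space d n" "symp d u v = 0"
  shows "weyl d u * weyl d v = weyl d (phase_add d u v)"
proof -
  obtain a b where u: "u = (a, b)" by (cases u)
  obtain a' b' where v: "v = (a', b')" by (cases v)
  have "d > 0" using assms(1) by (cases d) auto
  have Zv: "a \<in> Zvec d n" "b \<in> Zvec d n" "a' \<in> Zvec d n" "b' \<in> Zvec d n"
    using assms by (auto simp: u v phase_space_def)
  then have len: "length a = n" "length b = n" "length a' = n" "length b' = n"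
    by (auto simp: Zvec_def)
  define h where "h = modular_inverse (int d) 2"
  let ?Z = "pauli_Z_vec d a" and ?X = "pauli_X_vec d b"
  let ?Z' = "pauli_Z_vec d a'" and ?X' = "pauli_X_vec d b'"
  let ?N = "d ^ n"
  note c = pauli_vec_carrier(2)[OF len(1), of d] pauli_vec_carrier(1)[OF len(2), of d]
    pauli_vec_carrier(2)[OF len(3), of d] pauli_vec_carrier(1)[OF len(4), of d]
  note assoc = assoc_mult_mat[of _ ?N ?N _ ?N _ ?N]
  note smul = mult_smult_distrib[of _ ?N ?N _ ?N] mult_smult_assoc_mat[of _ ?N ?N _ ?N]
  have comm: "?X * ?Z' = omega d powi (- dot d a' b) \<cdot>\<^sub>m (?Z' * ?X)"
    using Zv \<open>d > 0\<close> by (intro pauli_X_vec_mult_pauli_Z_vec) (auto simp: Zvec_def Zmod_def)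
  have sumZ: "?Z * ?Z' = pauli_Z_vec d (Zvec_add d a a')"
    unfolding pauli_Z_vec_def by (rule kron_list_pow_add) (use Zv pauli_Z_pow_mod in auto)
  have sumX: "?X * ?X' = pauli_X_vec d (Zvec_add d b b')"
    unfolding pauli_X_vec_def by (rule kron_list_pow_add) (use Zv pauli_X_pow_mod in auto)
  have mid: "(?Z * ?X) * (?Z' * ?X')
      = omega d powi (- dot d a' b) \<cdot>\<^sub>m (pauli_Z_vec d (Zvec_add d a a') * pauli_X_vec d (Zvec_add d b b'))"
  proof -
    have "(?Z * ?X) * (?Z' * ?X') = ?Z * ((?X * ?Z') * ?X')"
      using c by (simp add: assoc)
    also have "\<dots> = omega d powi (- dot d a' b) \<cdot>\<^sub>m (?Z * ((?Z' * ?X) * ?X'))"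
      unfolding comm using c by (simp add: smul)
    also have "?Z * ((?Z' * ?X) * ?X') = (?Z * ?Z') * (?X * ?X')"
      using c by (simp add: assoc)
    finally show ?thesis unfolding sumZ sumX .
  qed
  have ZXc: "?Z * ?X \<in> carrier_mat ?N ?N" "?Z' * ?X' \<in> carrier_mat ?N ?N"
    using c by (auto intro: mult_carrier_mat)
  have "weyl d u * weyl d v
    = (omega d powi (- (h * dot d a b)) * omega d powi (- (h * dot d a' b'))) \<cdot>\<^sub>m
        ((?Z * ?X) * (?Z' * ?X'))"
    using ZXc by (simp add: weyl_def u v h_def smul smult_smult_mat mult_ac)
  also have "\<dots> = (omega d powi (- (h * dot d a b)) * omega d powi (- (h * dot d a' b')) *
      omega d powi (- dot d a' b)) \<cdot>\<^sub>m
      (pauli_Z_vec d (Zvec_add d a a') * pauli_X_vec d (Zvec_add d b b'))"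
    unfolding mid smult_smult_mat ..
  also have "omega d powi (- (h * dot d a b)) * omega d powi (- (h * dot d a' b')) *
      omega d powi (- dot d a' b) = omega d powi (- (h * dot d a b) - h * dot d a' b' - dot d a' b)"
    by (simp add: power_int_diff power_int_minus divide_simps)
  also have "\<dots> = omega d powi (- (h * dot d (Zvec_add d a a') (Zvec_add d b b')))"
  proof (rule omega_powi_cong[OF \<open>d > 0\<close>])
    let ?m = "int d"
    have "coprime ?m 2" using assms(1) by simp
    \<comment> \<open>Oddness of d is what makes \<open>h\<close> a genuine half.\<close>
    then have half: "[2 * h = 1] (mod ?m)"
      unfolding h_def by (intro cong_modular_inverse1) (simp add: coprime_commute)
    \<comment> \<open>The vanishing symplectic form, read as equality of the two cross
      terms.\<close>
    have sym: "[dot d a b' = dot d a' b] (mod ?m)"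
      using assms(4) dot_commute[of b a' d] len
      by (simp add: symp_def u v cong_iff_dvd_diff mod_eq_0_iff_dvd)
    have "[dot d (Zvec_add d a a') (Zvec_add d b b')
      = dot d (Zvec_add d a a') b + dot d (Zvec_add d a a') b'] (mod ?m)"
      using len by (intro dot_add_right) auto
    also have "[dot d (Zvec_add d a a') b + dot d (Zvec_add d a a') b'
      = (dot d a b + dot d a' b) + (dot d a b' + dot d a' b')] (mod ?m)"
      using len by (intro cong_add dot_add_left) auto
    also have "[(dot d a b + dot d a' b) + (dot d a b' + dot d a' b')
      = (dot d a b + dot d a' b) + (dot d a' b + dot d a' b')] (mod ?m)"
      by (intro cong_add sym cong_refl)
    finally have "[h * dot d (Zvec_add d a a') (Zvec_add d b b')
      = h * ((dot d a b + dot d a' b) + (dot d a' b + dot d a' b'))] (mod ?m)"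
      by (intro cong_mult cong_refl)
    also have "h * ((dot d a b + dot d a' b) + (dot d a' b + dot d a' b'))
      = h * dot d a b + h * dot d a' b' + 2 * h * dot d a' b"
      by (simp add: algebra_simps)
    also have "[h * dot d a b + h * dot d a' b' + 2 * h * dot d a' b
      = h * dot d a b + h * dot d a' b' + 1 * dot d a' b] (mod ?m)"
      by (intro cong_add cong_mult half cong_refl)
    finally have "[- (h * dot d (Zvec_add d a a') (Zvec_add d b b'))
      = - (h * dot d a b + h * dot d a' b' + 1 * dot d a' b)] (mod ?m)"
      by (simp only: cong_minus_minus_iff)
    moreover have "- (h * dot d a b) - h * dot d a' b' - dot d a' b
      = - (h * dot d a b + h * dot d a' b' + 1 * dot d a' b)" by simp
    ultimately show "(- (h * dot d a b) - h * dot d a' b' - dot d a' b) mod ?m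
      = (- (h * dot d (Zvec_add d a a') (Zvec_add d b b'))) mod ?m"
      by (simp only: cong_def)
  qed
  also have "omega d powi (- (h * dot d (Zvec_add d a a') (Zvec_add d b b'))) \<cdot>\<^sub>m
      (pauli_Z_vec d (Zvec_add d a a') * pauli_X_vec d (Zvec_add d b b')) = weyl d (phase_add d u v)"
    by (simp add: weyl_def u v phase_add_def h_def)
  finally show ?thesis .
qed

lemma symp_swap:
  assumes "u \<in> phase_space d n" "v \<in> phase_space d n" "symp d u v = 0"
  shows "symp d v u = 0"
proof -
  have "dot d (fst v) (snd u) = dot d (snd u) (fst v)" "dot d (snd v) (fst u) = dot d (fst u) (snd v)"
    using assms(1,2) by (auto simp: phase_space_def Zvec_def intro!: dot_commute)
  then show ?thesis
    using assms(3) by (simp add: symp_def mod_eq_0_iff_dvd dvd_diff_commute)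
qed

text \<open>Both products are the operator of u + v, and addition is symmetric.\<close>

lemma weyl_commute:
  assumes "odd d" "u \<in> phase_space d n" "v \<in> phase_space d n" "symp d u v = 0"
  shows "weyl d u * weyl d v = weyl d v * weyl d u"
  using weyl_mult[OF assms] weyl_mult[OF assms(1,3,2) symp_swap[OF assms(2-4)]]
  by (simp add: phase_add_commute)

section \<open>Powers of Heisenberg-Weyl operators\<close>

definition Zvec_scale :: "nat \<Rightarrow> int \<Rightarrow> int list \<Rightarrow> int list" where
  "Zvec_scale d k a = map (\<lambda>x. (k * x) mod int d) a"

definition phase_scale :: "nat \<Rightarrow> int \<Rightarrow> phase_vec \<Rightarrow> phase_vec" where
  "phase_scale d k u = (Zvec_scale d k (fst u), Zvec_scale d k (snd u))"

lemma phase_scale_closed: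
  assumes "d > 0" "u \<in> phase_space d n"
  shows "phase_scale d k u \<in> phase_space d n"
  using assms by (auto simp: phase_space_def phase_scale_def Zvec_scale_def Zvec_def Zmod_def)

lemma dot_scale_left:
  assumes "length a = length b"
  shows "[dot d (Zvec_scale d k a) b = k * dot d a b] (mod int d)"
proof -
  have "[(\<Sum>(x, y)\<leftarrow>zip (Zvec_scale d k a) b. x * y) = k * (\<Sum>(x, y)\<leftarrow>zip a b. x * y)] (mod int d)"
    using assms
  proof (induction a b rule: list_induct2)
    case (Cons x xs y ys)
    have "[(k * x) mod int d * y = k * x * y] (mod int d)"
      by (intro cong_mult) (simp_all add: cong_def)
    from cong_add[OF this Cons.IH] show ?case
      by (simp add: Zvec_scale_def algebra_simps)
  qed (simp add: Zvec_scale_def)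
  then show ?thesis by (simp add: dot_def cong_def mod_simps)
qed

lemma symp_scale_self:
  assumes "u \<in> phase_space d n"
  shows "symp d (phase_scale d k u) u = 0"
proof -
  have len: "length (fst u) = n" "length (snd u) = n"
    using assms by (auto simp: phase_space_def Zvec_def)
  have "[dot d (Zvec_scale d k (fst u)) (snd u) - dot d (Zvec_scale d k (snd u)) (fst u)
    = k * dot d (fst u) (snd u) - k * dot d (snd u) (fst u)] (mod int d)"
    using len by (intro cong_diff dot_scale_left) auto
  then show ?thesis
    using len dot_commute[of "fst u" "snd u" d] by (simp add: symp_def phase_scale_def cong_def)
qed

text \<open>The form is bilinear and alternating, so ku and u are orthogonal and the multiplication
  law applies at each step.\<close>

lemma weyl_pow:
  assumes "odd d" "u \<in> phase_space d n"
  shows "weyl d u ^\<^sub>m k = weyl d (phase_scale d (int k) u)"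
proof (induction k)
  case 0
  obtain a b where u: "u = (a, b)" by (cases u)
  have len: "length a = n" "length b = n" using assms by (auto simp: u phase_space_def Zvec_def)
  \<comment> \<open>At the zero vector all tensor factors are zeroth powers; the fact after this one
    makes the phase trivial.\<close>
  have one: "kron_list (map (\<lambda>x. A ^\<^sub>m 0) xs) = 1\<^sub>m (d ^ length xs)" if "A \<in> carrier_mat d d" for A and xs :: "int list"
    using that by (induction xs) (simp_all add: kron_one)
  have "(\<Sum>(x, y)\<leftarrow>zip (map (\<lambda>x. 0) a) (map (\<lambda>x. 0) b). x * y) = (0 :: int)"
    using len by (induction a b arbitrary: n rule: list_induct2') auto
  then have "weyl d (phase_scale d 0 u) = 1\<^sub>m (d ^ n)"
    using one[OF pauli_X_carrier, of b] one[OF pauli_Z_carrier, of a] len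
    by (simp add: weyl_def u phase_scale_def Zvec_scale_def dot_def pauli_X_vec_def pauli_Z_vec_def
        comp_def)
  then show ?case using weyl_carrier[OF assms(2)] by simp
next
  case (Suc k)
  have "d > 0" using assms(1) by (cases d) auto
  have "Zvec_add d (Zvec_scale d (int k) a) a = Zvec_scale d (int (Suc k)) a" for a
    unfolding Zvec_add_def Zvec_scale_def
    by (rule nth_equalityI) (auto simp: algebra_simps mod_simps)
  then have "phase_add d (phase_scale d (int k) u) u = phase_scale d (int (Suc k)) u"
    by (simp add: phase_add_def phase_scale_def)
  then show ?case
    using weyl_mult[OF assms(1) phase_scale_closed[OF \<open>d > 0\<close> assms(2)] assms(2) symp_scale_self[OF assms(2)]]
    by (simp add: Suc)
qed

text \<open>The vectors du and 0u coincide, so the powers with exponents d and 0 are the same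
  operator.\<close>

lemma weyl_pow_d:
  assumes "odd d" "u \<in> phase_space d n"
  shows "weyl d u ^\<^sub>m d = 1\<^sub>m (d ^ n)"
proof -
  have "phase_scale d (int d) u = phase_scale d (int 0) u"
    by (simp add: phase_scale_def Zvec_scale_def)
  then have "weyl d u ^\<^sub>m d = weyl d u ^\<^sub>m 0"
    by (simp only: weyl_pow[OF assms])
  then show ?thesis using weyl_carrier[OF assms(2)] by simp
qed

lemma contexts_commuting_family:
  assumes "odd d" "C \<in> contexts d n"
  shows "commuting_family d (d ^ n) C"
proof -
  have "d > 0" using assms(1) by (cases d) auto
  have "A \<in> carrier_mat (d ^ n) (d ^ n) \<and> A ^\<^sub>m d = 1\<^sub>m (d ^ n) \<and> mat_adjoint A * A = 1\<^sub>m (d ^ n)"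
    if "A \<in> set C" for A
  proof -
    have "A \<in> weyl d ` phase_space d n"
      using that assms(2) by (auto simp: contexts_def)
    then obtain u where "u \<in> phase_space d n" "A = weyl d u" by blast
    then show ?thesis
      using weyl_carrier weyl_pow_d[OF assms(1)] weyl_unitary[OF \<open>d > 0\<close>] by blast
  qed
  moreover have "\<forall>A\<in>set C. \<forall>B\<in>set C. A * B = B * A"
    using assms(2) unfolding contexts_def by blast
  ultimately show ?thesis unfolding commuting_family_def by blast
qed

section \<open>Non-contextuality\<close>

lemma singleton_context:
  "u \<in> phase_space d n \<Longrightarrow> [weyl d u] \<in> contexts d n"
  by (simp add: contexts_def)

lemma Zvec_1: "Zvec d (Suc 0) = (\<lambda>k. [k]) ` Zmod d"
  by (auto simp: Zvec_Suc)

lemma eigenprojector_singleton: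
  assumes "odd d" "u \<in> phase_space d n"
  shows "eigenprojector d n [weyl d u] [k] = spec_proj d (d ^ n) (weyl d u) k"
proof -
  have "d > 0" using assms(1) by (cases d) auto
  then have "eigenprojector d n [weyl d u] [k] = joint_proj d (d ^ n) [weyl d u] [k]"
    using contexts_commuting_family[OF assms(1) singleton_context[OF assms(2)]]
    by (intro eigenprojector_eq_joint_proj) auto
  then show ?thesis by (simp add: right_mult_one_mat[of _ "d ^ n" "d ^ n"])
qed

text \<open>The two implementations compared are \<open>[weyl d u]\<close> itself and \<open>C\<close> with outcomes
  coarse-grained by \<open>f\<close>.\<close>

lemma noncontextual_value:
  assumes "odd d" "deterministic_with d n S p \<alpha>" "noncontextual d n S p"
    and \<nu>: "\<nu> \<in> S" and u: "u \<in> phase_space d n" and C: "C \<in> contexts d n"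
    and f: "f ` Zvec d (length C) = Zmod d"
    and eig: "\<And>t. t \<in> Zvec d (length C) \<Longrightarrow>
      weyl d u * joint_proj d (d ^ n) C t = omega d powi (f t) \<cdot>\<^sub>m joint_proj d (d ^ n) C t"
  shows "\<alpha> \<nu> [weyl d u] = [f (\<alpha> \<nu> C)]"
proof -
  have "d > 0" using assms(1) by (cases d) auto
  let ?Z = "Zvec d (length C)" and ?T = "[weyl d u]" and ?N = "d ^ n"
  define P where "P = eigenprojector d n ?T"
  \<comment> \<open>Outcomes of a singleton context are one-element lists, so the residue is
    wrapped.\<close>
  define \<sigma> where "\<sigma> t = [f t]" for t
  have T: "?T \<in> contexts d n" by (rule singleton_context[OF u])
  have P: "P [k] = mat_sum ?N (eigenprojector d n C) {t \<in> ?Z. \<sigma> t = [k]}" if "k \<in> Zmod d" for k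
  proof -
    have "P [k] = mat_sum ?N (joint_proj d ?N C) {t \<in> ?Z. f t = k}"
      unfolding P_def eigenprojector_singleton[OF assms(1) u]
    proof (rule spec_proj_eq_sum_joint_proj[OF \<open>d > 0\<close> _ weyl_carrier[OF u] _ eig that])
      show "commuting_family d ?N C" by (rule contexts_commuting_family[OF assms(1) C])
      show "f t \<in> Zmod d" if "t \<in> ?Z" for t using f that by blast
    qed
    also have "\<dots> = mat_sum ?N (eigenprojector d n C) {t \<in> ?Z. f t = k}"
    proof (rule mat_sum_cong)
      fix t assume "t \<in> {t \<in> ?Z. f t = k}"
      then have "length t = length C" by (simp add: Zvec_def)
      then show "joint_proj d ?N C t = eigenprojector d n C t"
        by (rule eigenprojector_eq_joint_proj[OF \<open>d > 0\<close> contexts_commuting_family[OF assms(1) C], symmetric])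
    qed
    also have "{t \<in> ?Z. f t = k} = {t \<in> ?Z. \<sigma> t = [k]}" by (simp add: \<sigma>_def)
    finally show ?thesis .
  qed
  have P': "P [k] = mat_sum ?N P {t \<in> Zvec d (length ?T). t = [k]}" if "k \<in> Zmod d" for k
  proof -
    have "{t \<in> Zvec d (length ?T). t = [k]} = {[k]}" using that by (auto simp: Zvec_1)
    then show ?thesis
      by (intro eq_matI) (simp_all add: P_def eigenprojector_singleton[OF assms(1) u])
  qed
  have "mat_sum ?N P (Zvec d 1) = mat_sum ?N (spec_proj d ?N (weyl d u)) (Zmod d)"
    by (simp add: mat_sum_def Zvec_1 sum.reindex inj_on_def P_def eigenprojector_singleton[OF assms(1) u])
  also have "\<dots> = 1\<^sub>m ?N"
    using \<open>d > 0\<close> weyl_carrier[OF u] by (rule sum_spec_proj)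
  finally have sum1: "mat_sum ?N P (Zvec d 1) = 1\<^sub>m ?N" .
  have "stabilizer_projector d n (P s)" if s: "s \<in> Zvec d 1" for s
  proof -
    obtain k where "s = [k]" "k \<in> Zmod d" using s by (auto simp: Zvec_1)
    then have "P s = mat_sum ?N (eigenprojector d n ?T) {t \<in> Zvec d (length ?T). t = [k]}"
      using P' P_def by simp
    then show ?thesis unfolding stabilizer_projector_def using T
      by (intro bexI[of _ ?T] exI[of _ "{t \<in> Zvec d (length ?T). t = [k]}"] conjI) auto
  qed
  then have meas: "measurement d n (Zvec d 1) P"
    unfolding measurement_def using sum1 finite_Zvec by blast
  have impl: "implementation d n (Zvec d 1) P C \<sigma>"
    unfolding implementation_def
  proof (intro conjI ballI)
    have "\<sigma> ` ?Z = (\<lambda>k. [k]) ` f ` ?Z" by (simp add: \<sigma>_def image_image)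
    then show "\<sigma> ` ?Z = Zvec d 1" by (simp add: f Zvec_1)
    fix s assume "s \<in> Zvec d 1"
    then obtain k where "s = [k]" "k \<in> Zmod d" by (auto simp: Zvec_1)
    then show "P s = mat_sum ?N (eigenprojector d n C) {t \<in> ?Z. \<sigma> t = s}"
      using P by simp
  qed (rule C)
  have impl': "implementation d n (Zvec d 1) P ?T (\<lambda>t. t)"
    unfolding implementation_def
  proof (intro conjI ballI)
    fix s assume "s \<in> Zvec d 1"
    then obtain k where "s = [k]" "k \<in> Zmod d" by (auto simp: Zvec_1)
    then show "P s = mat_sum ?N (eigenprojector d n ?T) {t \<in> Zvec d (length ?T). t = s}"
      using P' by (simp only: P_def)
  qed (use T in simp_all)
  have det: "\<alpha> \<nu> D \<in> Zvec d (length D)"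
    "\<And>s. s \<in> Zvec d (length D) \<Longrightarrow> p D s \<nu> = (if \<alpha> \<nu> D = s then 1 else 0)"
    if "D \<in> contexts d n" for D
    using assms(2) \<nu> that unfolding deterministic_with_def by blast+
  \<comment> \<open>The label under test is the coarse-grained outcome assigned to C. It has
    probability 1 through C, hence also through the singleton context, and a deterministic response
    equals 1 only at its assigned value.\<close>
  let ?s = "\<sigma> (\<alpha> \<nu> C)"
  have s: "?s \<in> Zvec d 1" using det(1)[OF C] f by (auto simp: \<sigma>_def Zvec_1)
  have "coarse_prob d p C \<sigma> ?s \<nu> = coarse_prob d p ?T (\<lambda>t. t) ?s \<nu>"
    by (rule assms(3)[unfolded noncontextual_def, rule_format,
          of "Zvec d 1" P C \<sigma> "Zvec d 1" P ?T "\<lambda>t. t"])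
      (simp_all only: meas impl impl' s \<nu> simp_thms)
  moreover have "coarse_prob d p C \<sigma> ?s \<nu> = 1"
  proof -
    have "coarse_prob d p C \<sigma> ?s \<nu>
      = (\<Sum>t\<in>{t \<in> ?Z. \<sigma> t = ?s}. if \<alpha> \<nu> C = t then 1 else 0)"
      unfolding coarse_prob_def by (intro sum.cong) (auto simp: det(2)[OF C])
    then show ?thesis using det(1)[OF C] by simp
  qed
  moreover have "coarse_prob d p ?T (\<lambda>t. t) ?s \<nu> = p ?T ?s \<nu>"
  proof -
    have "{t \<in> Zvec d (length ?T). t = ?s} = {?s}" using s by auto
    then show ?thesis by (simp add: coarse_prob_def)
  qed
  ultimately have "p ?T ?s \<nu> = 1" by simp
  then have "\<alpha> \<nu> ?T = ?s" using det(2)[OF T, of ?s] s by (auto split: if_splits)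
  then show ?thesis by (simp add: \<sigma>_def)
qed

text \<open>Contexts are lists, so u = v is no exception: the operator is then listed twice, and
  outcomes with different entries have zero projector. Keeping them as labels leaves the three
  coarse-grainings surjective.\<close>

lemma noncontextual_value_add:
  assumes "odd d" "deterministic_with d n S p \<alpha>" "noncontextual d n S p"
    and \<nu>: "\<nu> \<in> S" and u: "u \<in> phase_space d n" and v: "v \<in> phase_space d n"
    and "symp d u v = 0"
  shows "\<alpha> \<nu> [weyl d (phase_add d u v)] ! 0
    = (\<alpha> \<nu> [weyl d u] ! 0 + \<alpha> \<nu> [weyl d v] ! 0) mod int d"
proof -
  have "d > 0" using assms(1) by (cases d) auto
  define C where "C = [weyl d u, weyl d v]"
  let ?N = "d ^ n" and ?Z = "Zvec d (length C)"
  have C: "C \<in> contexts d n"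
    using u v weyl_commute[OF assms(1) u v assms(7)] by (auto simp: contexts_def C_def)
  have Z: "?Z = (\<lambda>(j, k). [j, k]) ` (Zmod d \<times> Zmod d)"
    by (auto simp: C_def Zvec_Suc image_iff)
  \<comment> \<open>In the surjectivity proofs below, 0 fills the entry that is free to
    choose.\<close>
  have z: "0 \<in> Zmod d" using \<open>d > 0\<close> by (simp add: Zmod_def)
  have eig: "weyl d u * joint_proj d ?N C t = omega d powi (t ! 0) \<cdot>\<^sub>m joint_proj d ?N C t"
    "weyl d v * joint_proj d ?N C t = omega d powi (t ! 1) \<cdot>\<^sub>m joint_proj d ?N C t"
    if "t \<in> ?Z" for t
    using joint_proj_eigen[OF \<open>d > 0\<close> contexts_commuting_family[OF assms(1) C], of 0 t]
      joint_proj_eigen[OF \<open>d > 0\<close> contexts_commuting_family[OF assms(1) C], of 1 t] that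
    by (auto simp: C_def Zvec_def)
  \<comment> \<open>T_{u+v} = T_u T_v multiplies the two eigenvalues, so the exponents add; the sum
    is reduced to be a residue label.\<close>
  have eig_add: "weyl d (phase_add d u v) * joint_proj d ?N C t
      = omega d powi ((t ! 0 + t ! 1) mod int d) \<cdot>\<^sub>m joint_proj d ?N C t" if "t \<in> ?Z" for t
  proof -
    let ?P = "joint_proj d ?N C t"
    note c = weyl_carrier[OF u] weyl_carrier[OF v] joint_proj_carrier[of d ?N C t]
    have "weyl d (phase_add d u v) * ?P = weyl d u * weyl d v * ?P"
      by (simp add: weyl_mult[OF assms(1) u v assms(7)])
    also have "\<dots> = weyl d u * (weyl d v * ?P)" by (rule assoc_mult_mat[OF c])
    also have "\<dots> = omega d powi (t ! 1) \<cdot>\<^sub>m (weyl d u * ?P)"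
      unfolding eig(2)[OF that] by (rule mult_smult_distrib[OF c(1,3)])
    also have "\<dots> = (omega d powi (t ! 1) * omega d powi (t ! 0)) \<cdot>\<^sub>m ?P"
      unfolding eig(1)[OF that] smult_smult_mat ..
    also have "omega d powi (t ! 1) * omega d powi (t ! 0) = omega d powi ((t ! 0 + t ! 1) mod int d)"
      using \<open>d > 0\<close> by (simp add: power_int_add)
    finally show ?thesis .
  qed
  note val = noncontextual_value[OF assms(1,2,3) \<nu> _ C]
  have "\<alpha> \<nu> [weyl d u] = [\<alpha> \<nu> C ! 0]"
  proof (rule val[OF u _ eig(1)])
    show "(\<lambda>t. t ! 0) ` ?Z = Zmod d" using z by (force simp: Z image_image)
  qed
  moreover have "\<alpha> \<nu> [weyl d v] = [\<alpha> \<nu> C ! 1]"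
  proof (rule val[OF v _ eig(2)])
    show "(\<lambda>t. t ! 1) ` ?Z = Zmod d" using z by (force simp: Z image_image)
  qed
  moreover have "\<alpha> \<nu> [weyl d (phase_add d u v)] = [(\<alpha> \<nu> C ! 0 + \<alpha> \<nu> C ! 1) mod int d]"
  proof (rule val[OF phase_add_closed[OF \<open>d > 0\<close> u v] _ eig_add])
    show "(\<lambda>t. (t ! 0 + t ! 1) mod int d) ` ?Z = Zmod d"
    proof (intro equalityI subsetI)
      fix k assume k: "k \<in> Zmod d"
      \<comment> \<open>The outcome \<open>[k, 0]\<close> has entry sum k.\<close>
      then show "k \<in> (\<lambda>t. (t ! 0 + t ! 1) mod int d) ` ?Z"
        using z by (intro image_eqI[of _ _ "[k, 0]"]) (auto simp: Z Zmod_def)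
    qed (use \<open>d > 0\<close> in \<open>auto simp: Z Zmod_def\<close>)
  qed
  ultimately show ?thesis by simp
qed

section \<open>The trace condition and the conclusion\<close>

lemma mat_trace_mat_sum_mult:
  assumes "\<And>t. t \<in> S \<Longrightarrow> f t \<in> carrier_mat N N" "\<rho> \<in> carrier_mat N N"
  shows "mat_trace (mat_sum N f S * \<rho>) = (\<Sum>t\<in>S. mat_trace (f t * \<rho>))"
proof -
  have "mat_trace (mat_sum N f S * \<rho>) = mat_trace (mat_sum N (\<lambda>t. f t * \<rho>) S)"
    using assms by (simp add: mat_sum_mult)
  also have "\<dots> = (\<Sum>i<N. \<Sum>t\<in>S. (f t * \<rho>) $$ (i, i))"
    unfolding mat_trace_def by (intro sum.cong) auto
  also have "\<dots> = (\<Sum>t\<in>S. \<Sum>i<N. (f t * \<rho>) $$ (i, i))"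
    by (rule sum.swap)
  also have "\<dots> = (\<Sum>t\<in>S. mat_trace (f t * \<rho>))"
    unfolding mat_trace_def using assms(1) by (intro sum.cong) (auto dest: carrier_matD(1))
  finally show ?thesis .
qed

lemma mat_trace_weyl:
  assumes "odd d" "u \<in> phase_space d n" "\<rho> \<in> carrier_mat (d ^ n) (d ^ n)"
  shows "mat_trace (weyl d u * \<rho>)
    = (\<Sum>k\<in>Zmod d. omega d powi k * mat_trace (eigenprojector d n [weyl d u] [k] * \<rho>))"
proof -
  have "d > 0" using assms(1) by (cases d) auto
  let ?N = "d ^ n" and ?E = "spec_proj d (d ^ n) (weyl d u)"
  have "mat_trace (weyl d u * \<rho>)
    = mat_trace (mat_sum ?N (\<lambda>k. omega d powi k \<cdot>\<^sub>m ?E k) (Zmod d) * \<rho>)"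
    using sum_omega_spec_proj[OF \<open>d > 0\<close> weyl_carrier[OF assms(2)] weyl_pow_d[OF assms(1,2)]] by simp
  also have "\<dots> = (\<Sum>k\<in>Zmod d. mat_trace ((omega d powi k \<cdot>\<^sub>m ?E k) * \<rho>))"
    using assms(3) by (intro mat_trace_mat_sum_mult) auto
  also have "\<dots> = (\<Sum>k\<in>Zmod d. omega d powi k * mat_trace (?E k * \<rho>))"
  proof (rule sum.cong)
    fix k
    have "(omega d powi k \<cdot>\<^sub>m ?E k) * \<rho> = omega d powi k \<cdot>\<^sub>m (?E k * \<rho>)"
      using assms(3) by (intro mult_smult_assoc_mat[of _ ?N ?N]) auto
    moreover have "dim_row (?E k * \<rho>) = ?N" "dim_col (?E k * \<rho>) = ?N"
      using assms(3) by auto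
    ultimately show "mat_trace ((omega d powi k \<cdot>\<^sub>m ?E k) * \<rho>) = omega d powi k * mat_trace (?E k * \<rho>)"
      unfolding mat_trace_def sum_distrib_left by (intro sum.cong) simp_all
  qed simp
  finally show ?thesis by (simp only: eigenprojector_singleton[OF assms(1,2)])
qed

lemma has_sum_finite_sum:
  fixes f :: "'a \<Rightarrow> 'b \<Rightarrow> 'c :: topological_comm_monoid_add"
  assumes "finite B" "\<And>b. b \<in> B \<Longrightarrow> (f b has_sum s b) A"
  shows "((\<lambda>x. \<Sum>b\<in>B. f b x) has_sum (\<Sum>b\<in>B. s b)) A"
  using assms by (induction B rule: finite_induct) (auto intro: has_sum_add)

text \<open>Weight the model's identity for outcome k by omega^k and add over k. S may be infinite,
  but only d convergent sums are added. For each hidden state the response is a delta, so only the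
  assigned outcome contributes its phase.\<close>

lemma has_sum_value_trace:
  assumes "odd d" "\<rho> \<in> carrier_mat (d ^ n) (d ^ n)"
    and "hidden_variable_model d n \<rho> S q p" "deterministic_with d n S p \<alpha>"
    and u: "u \<in> phase_space d n"
  shows "((\<lambda>\<nu>. omega d powi (\<alpha> \<nu> [weyl d u] ! 0) * of_real (q \<nu>)) has_sum mat_trace (weyl d u * \<rho>)) S"
proof -
  let ?T = "[weyl d u]"
  have T: "?T \<in> contexts d n" by (rule singleton_context[OF u])
  have "((\<lambda>\<nu>. \<Sum>k\<in>Zmod d. omega d powi k * of_real (p ?T [k] \<nu> * q \<nu>)) has_sum
      (\<Sum>k\<in>Zmod d. omega d powi k * mat_trace (eigenprojector d n ?T [k] * \<rho>))) S"
  proof (intro has_sum_finite_sum has_sum_cmult_right finite_Zmod)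
    fix k assume "k \<in> Zmod d"
    then have "[k] \<in> Zvec d (length ?T)" by (simp add: Zvec_1)
    then show "((\<lambda>\<nu>. of_real (p ?T [k] \<nu> * q \<nu>)) has_sum mat_trace (eigenprojector d n ?T [k] * \<rho>)) S"
      using assms(3) T unfolding hidden_variable_model_def by blast
  qed
  also have "(\<Sum>k\<in>Zmod d. omega d powi k * mat_trace (eigenprojector d n ?T [k] * \<rho>))
      = mat_trace (weyl d u * \<rho>)"
    by (rule mat_trace_weyl[OF assms(1) u assms(2), symmetric])
  finally have *: "((\<lambda>\<nu>. \<Sum>k\<in>Zmod d. omega d powi k * of_real (p ?T [k] \<nu> * q \<nu>)) has_sum
      mat_trace (weyl d u * \<rho>)) S" .
  show ?thesis
  proof (rule has_sum_cong[THEN iffD1, OF _ *])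
    fix \<nu> assume \<nu>: "\<nu> \<in> S"
    have \<alpha>: "\<alpha> \<nu> ?T \<in> Zvec d (length ?T)"
      and p: "\<And>s. s \<in> Zvec d (length ?T) \<Longrightarrow> p ?T s \<nu> = (if \<alpha> \<nu> ?T = s then 1 else 0)"
      using assms(4) \<nu> T unfolding deterministic_with_def by blast+
    from \<alpha> obtain a where a: "\<alpha> \<nu> ?T = [a]" "a \<in> Zmod d" by (auto simp: Zvec_1)
    have "(\<Sum>k\<in>Zmod d. omega d powi k * of_real (p ?T [k] \<nu> * q \<nu>))
      = (\<Sum>k\<in>Zmod d. if a = k then omega d powi k * of_real (q \<nu>) else 0)"
      using p by (intro sum.cong) (auto simp: a Zvec_1)
    then show "(\<Sum>k\<in>Zmod d. omega d powi k * of_real (p ?T [k] \<nu> * q \<nu>))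
      = omega d powi (\<alpha> \<nu> ?T ! 0) * of_real (q \<nu>)"
      using a by simp
  qed
qed

text \<open>A hidden variable model lives on an arbitrary set, NC value assignments on a finite one;
  so the conditions are shown for every S and finiteness becomes a premise. \<open>l\<close> is
  prescribed exactly where the conditions evaluate it.\<close>

theorem corollary2:
  fixes d n :: nat and \<rho> :: "complex mat" and S :: "'h set" and q :: "'h \<Rightarrow> real"
    and p :: "'h response" and \<alpha> :: "'h \<Rightarrow> complex mat list \<Rightarrow> int list"
    and l :: "'h \<Rightarrow> phase_vec \<Rightarrow> complex"
  assumes "odd d"
    and "density_matrix (d ^ n) \<rho>"
    and "hidden_variable_model d n \<rho> S q p"
    and "deterministic_with d n S p \<alpha>"
    and "noncontextual d n S p"
    and "\<forall>\<nu>\<in>S. \<forall>u\<in>phase_space d n. l \<nu> u = omega d powi (\<alpha> \<nu> [weyl d u] ! 0)"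
  shows "value_assignments d n \<rho> S q l \<and> (finite S \<longrightarrow> nc_value_assignments d n \<rho> S q l)"
proof -
  have "d > 0" using assms(1) by (cases d) auto
  have l: "l \<nu> u = omega d powi (\<alpha> \<nu> [weyl d u] ! 0)" if "\<nu> \<in> S" "u \<in> phase_space d n" for \<nu> u
    using assms(6) that by blast
  have "value_assignments d n \<rho> S q l"
    unfolding value_assignments_def
  proof (intro conjI ballI impI)
    show "prob_dist_on S q"
      using assms(3) by (simp add: hidden_variable_model_def)
  next
    fix \<nu> u assume \<nu>: "\<nu> \<in> S" and u: "u \<in> phase_space d n"
    have "\<alpha> \<nu> [weyl d u] \<in> Zvec d (length [weyl d u])"
      using assms(4) \<nu> singleton_context[OF u] unfolding deterministic_with_def by blast
    then have "\<alpha> \<nu> [weyl d u] ! 0 \<in> Zmod d" by (auto simp: Zvec_1)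
    then show "l \<nu> u \<in> roots_U d"
      unfolding l[OF \<nu> u] roots_U_def by blast
  next
    fix \<nu> u v
    assume \<nu>: "\<nu> \<in> S" and u: "u \<in> phase_space d n" and v: "v \<in> phase_space d n"
      and uv: "symp d u v = 0"
    \<comment> \<open>The value at u + v is a sum reduced mod d, and the reduction disappears in the
      exponent of omega.\<close>
    show "l \<nu> (phase_add d u v) = l \<nu> u * l \<nu> v"
      unfolding l[OF \<nu> u] l[OF \<nu> v] l[OF \<nu> phase_add_closed[OF \<open>d > 0\<close> u v]]
        noncontextual_value_add[OF assms(1,4,5) \<nu> u v uv] omega_powi_mod[OF \<open>d > 0\<close>]
      by (rule power_int_add) simp
  next
    fix u assume u: "u \<in> phase_space d n"
    have "\<rho> \<in> carrier_mat (d ^ n) (d ^ n)" using assms(2) by (simp add: density_matrix_def)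
    from has_sum_value_trace[OF assms(1) this assms(3,4) u]
    show "((\<lambda>\<nu>. l \<nu> u * of_real (q \<nu>)) has_sum mat_trace (weyl d u * \<rho>)) S"
      by (rule has_sum_cong[THEN iffD1, rotated]) (simp add: l u)
  qed
  then show ?thesis by (simp add: nc_value_assignments_def)
qed

end
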